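(* Let $X$ be a conjugacy class of the Mathieu group $M_{24}$ of order $n$, and let $Y$ be a conjugacy class of powers of $12B$ of maximal order $k$ such that $X$ belongs to the power-up classes of $Y$. Then, for all but two counter-examples, the thread of the genus zero group corresponding to $X$ is $(2n|k)$. The values of $k$ so computed are: $k=1$ for $X=1A,2A,3A,4A,4B,5A,6A,7AB,8A,11A,12A,14AB,15AB,23AB$; $k=2$ for $X=2B,10A$; $k=3$ for $X=3B,21AB$; $k=4$ for $X=4C$; $k=6$ for $X=6B$; $k=12$ for $X=12B$. The two counter-examples are exactly the power-up classes of $4A$, namely $X=4A$ and $X=12A$, for which the thread is $(2n|2)$.
   Context: Conjugacy classes of $M_{24}$ have ATLAS names (the number is the order of the elements; $7AB$ etc. denotes a pair of algebraically conjugate classes), with the following cycle shapes on $24$ points: $1A$: $1^{24}$; $2A$: $1^82^8$; $2B$: $2^{12}$; $3A$: $1^63^6$; $3B$: $3^8$; $4A$: $2^44^4$; $4B$: $1^42^24^4$; $4C$: $4^6$; $5A$: $1^45^4$; $6A$: $1^22^23^26^2$; $6B$: $6^4$; $7AB$: $1^37^3$; $8A$: $1^2\,2\,4\,8^2$; $10A$: $2^210^2$; $11A$: $1^211^2$; $12A$: $2\,4\,6\,12$; $12B$: $12^2$; $14AB$: $1\,2\,7\,14$; $15AB$: $1\,3\,5\,15$; $21AB$: $3\,21$; $23AB$: $1\,23$. $X$ is a power-up class of $Y$ if some power $g^d$ ($d\ge1$) of an element $g\in X$ lies in $Y$ (so $Y$ is a power-up class of itself). The conjugacy classes of powers of $12B$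 are $12B,6B,4C,3B,2B,1A$. The thread of a genus zero group $n'|h+e,f,\dots$ ($h=1$ if omitted) is $(n'|h)$. The genus zero groups attached to the conjugacy classes of $M_{24}$ are: $1A$: $2-$; $2A$: $4-$; $2B$: $4|2-$; $3A$: $6+3$; $3B$: $6|3$; $4A$: $8|2-$; $4B$: $8-$; $4C$: $8|4-$; $5A$: $10+5$; $6A$: $12+3$; $6B$: $12|6-$; $7AB$: $14+7$; $8A$: $16-$; $10A$: $20|2+5$; $11A$: $22+11$; $12A$: $24|2+3$; $12B$: $24|12-$; $14AB$: $28+7$; $15AB$: $30+3,5,15$; $21AB$: $42|3+7$; $23AB$: $46+23$. *)

theory Defs
  imports
    "HOL-Algebra.Sym_Groups"
    "HOL-Algebra.Group_Action"
    "HOL-Algebra.Multiplicative_Group"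
    "HOL-Combinatorics.Orbits"
    "HOL-Library.Multiset"
    "HOL-Number_Theory.Number_Theory"
begin

text \<open>
  The 24 points are \<open>{1..24}\<close>, read as the projective line over the field with 23 elements:
  \<open>1, \<dots>, 23\<close> are the residues modulo 23 (so 23 plays the role of 0) and 24 is the point at
  infinity. The binary Golay code is the extended quadratic residue code of length 24: the
  subspace of the power set (a vector space over the field with 2 elements, with symmetric
  difference as addition) spanned by the translates of the set consisting of the quadratic
  nonresidues and infinity.
\<close>

definition golay_generator :: "nat \<Rightarrow> nat set" where
  "golay_generator i = insert 24 {x \<in> {1..23}. \<not> QuadRes 23 (int x - int i)}"

inductive_set golay_code :: "nat set set" where
  zero: "{} \<in> golay_code"
| add: "C \<in> golay_code \<Longrightarrow> i \<in> {1..23} \<Longrightarrow> sym_diff C (golay_generator i) \<in> golay_code"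

definition M24 :: "(nat \<Rightarrow> nat) monoid" where
  "M24 = (sym_group 24)
     \<lparr> carrier := {p \<in> carrier (sym_group 24). \<forall>C \<in> golay_code. p ` C \<in> golay_code} \<rparr>"

definition conj_classes :: "('a, 'b) monoid_scheme \<Rightarrow> 'a set set" where
  "conj_classes G =
     orbits G (carrier G) (\<lambda>g. \<lambda>h \<in> carrier G. g \<otimes>\<^bsub>G\<^esub> h \<otimes>\<^bsub>G\<^esub> inv\<^bsub>G\<^esub> g)"

text \<open>The common order of the elements of a conjugacy class.\<close>

definition class_order :: "('a, 'b) monoid_scheme \<Rightarrow> 'a set \<Rightarrow> nat" where
  "class_order G X = the_elem (group.ord G ` X)"

definition power_up :: "('a, 'b) monoid_scheme \<Rightarrow> 'a set \<Rightarrow> 'a set \<Rightarrow> bool" where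
  "power_up G X Y \<longleftrightarrow> (\<exists>g \<in> X. \<exists>d::nat. d \<ge> 1 \<and> g [^]\<^bsub>G\<^esub> d \<in> Y)"

text \<open>The multiset of cycle lengths on the 24 points, fixed points included.\<close>

definition cycle_shape :: "(nat \<Rightarrow> nat) \<Rightarrow> nat multiset" where
  "cycle_shape p = image_mset card (mset_set (Orbits.orbit p ` {1..24}))"

text \<open>The names ending in \<open>AB\<close> stand for either class of an algebraically conjugate pair.\<close>

datatype atlas_name =
    C1A | C2A | C2B | C3A | C3B | C4A | C4B | C4C | C5A | C6A | C6B | C7AB | C8A
  | C10A | C11A | C12A | C12B | C14AB | C15AB | C21AB | C23AB

fun atlas_shape :: "atlas_name \<Rightarrow> nat multiset" where
  "atlas_shape C1A = replicate_mset 24 1"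
| "atlas_shape C2A = replicate_mset 8 1 + replicate_mset 8 2"
| "atlas_shape C2B = replicate_mset 12 2"
| "atlas_shape C3A = replicate_mset 6 1 + replicate_mset 6 3"
| "atlas_shape C3B = replicate_mset 8 3"
| "atlas_shape C4A = replicate_mset 4 2 + replicate_mset 4 4"
| "atlas_shape C4B = replicate_mset 4 1 + replicate_mset 2 2 + replicate_mset 4 4"
| "atlas_shape C4C = replicate_mset 6 4"
| "atlas_shape C5A = replicate_mset 4 1 + replicate_mset 4 5"
| "atlas_shape C6A =
     replicate_mset 2 1 + replicate_mset 2 2 + replicate_mset 2 3 + replicate_mset 2 6"
| "atlas_shape C6B = replicate_mset 4 6"
| "atlas_shape C7AB = replicate_mset 3 1 + replicate_mset 3 7"
| "atlas_shape C8A = {#1, 1, 2, 4, 8, 8#}"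
| "atlas_shape C10A = replicate_mset 2 2 + replicate_mset 2 10"
| "atlas_shape C11A = replicate_mset 2 1 + replicate_mset 2 11"
| "atlas_shape C12A = {#2, 4, 6, 12#}"
| "atlas_shape C12B = replicate_mset 2 12"
| "atlas_shape C14AB = {#1, 2, 7, 14#}"
| "atlas_shape C15AB = {#1, 3, 5, 15#}"
| "atlas_shape C21AB = {#3, 21#}"
| "atlas_shape C23AB = {#1, 23#}"

text \<open>
  The 21 cycle shapes are pairwise different and every class of \<open>M24\<close> has one of them, so the
  description below picks out a unique name.
\<close>

definition atlas_name_of :: "(nat \<Rightarrow> nat) set \<Rightarrow> atlas_name" where
  "atlas_name_of X = (THE N. \<forall>g \<in> X. cycle_shape g = atlas_shape N)"

text \<open>\<open>GZ n h E\<close> is the symbol \<open>n|h+e,f,\<dots>\<close> with \<open>E = {e, f, \<dots>}\<close>; \<open>n-\<close> has \<open>E = {}\<close>.\<close>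

datatype genus_zero_symbol = GZ nat nat "nat set"

fun thread :: "genus_zero_symbol \<Rightarrow> nat \<times> nat" where
  "thread (GZ n h E) = (n, h)"

fun genus_zero_group :: "atlas_name \<Rightarrow> genus_zero_symbol" where
  "genus_zero_group C1A = GZ 2 1 {}"
| "genus_zero_group C2A = GZ 4 1 {}"
| "genus_zero_group C2B = GZ 4 2 {}"
| "genus_zero_group C3A = GZ 6 1 {3}"
| "genus_zero_group C3B = GZ 6 3 {}"
| "genus_zero_group C4A = GZ 8 2 {}"
| "genus_zero_group C4B = GZ 8 1 {}"
| "genus_zero_group C4C = GZ 8 4 {}"
| "genus_zero_group C5A = GZ 10 1 {5}"
| "genus_zero_group C6A = GZ 12 1 {3}"
| "genus_zero_group C6B = GZ 12 6 {}"
| "genus_zero_group C7AB = GZ 14 1 {7}"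
| "genus_zero_group C8A = GZ 16 1 {}"
| "genus_zero_group C10A = GZ 20 2 {5}"
| "genus_zero_group C11A = GZ 22 1 {11}"
| "genus_zero_group C12A = GZ 24 2 {3}"
| "genus_zero_group C12B = GZ 24 12 {}"
| "genus_zero_group C14AB = GZ 28 1 {7}"
| "genus_zero_group C15AB = GZ 30 1 {3, 5, 15}"
| "genus_zero_group C21AB = GZ 42 3 {7}"
| "genus_zero_group C23AB = GZ 46 1 {23}"

definition class_thread :: "(nat \<Rightarrow> nat) set \<Rightarrow> nat \<times> nat" where
  "class_thread X = thread (genus_zero_group (atlas_name_of X))"

definition class_of_powers_of_12B :: "(nat \<Rightarrow> nat) set \<Rightarrow> bool" where
  "class_of_powers_of_12B Y \<longleftrightarrow>
     Y \<in> conj_classes M24 \<and>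
     (\<exists>Z \<in> conj_classes M24. atlas_name_of Z = C12B \<and> power_up M24 Z Y)"

definition max_power_class :: "(nat \<Rightarrow> nat) set \<Rightarrow> (nat \<Rightarrow> nat) set \<Rightarrow> bool" where
  "max_power_class X Y \<longleftrightarrow>
     is_arg_max (class_order M24) (\<lambda>Y. class_of_powers_of_12B Y \<and> power_up M24 X Y) Y"

end

theory Submission
  imports Defs
begin

text \<open>
  The Golay code is the kernel of an explicit syndrome map, so that membership of a permutation in
  \<open>M24\<close> can be decided by evaluation. Explicit elements show that \<open>M24\<close> is transitive on ordered
  5-tuples of distinct points and has at most two orbits on ordered 6-tuples; hence the minimum weight
  of the code is 8, which bounds the pointwise stabilizer of five points: it consists of 48 explicit
  elements. By transitivity every element of \<open>M24\<close> is conjugate to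
  one that acts in one of 16 prescribed ways on five points, that is, to one of 768 explicit
  permutations. Evaluating these gives the 21 cycle shapes, and shows that the elements of the shapes
  2B, 3B, 4C, 6B are all conjugate to powers of one element of shape 12B, and that the shapes 4A and
  12A each form a single class.

  Powers of a 12B element act semiregularly. So if a power \<open>g ^ d\<close> is also a power of a 12B element,
  its order divides every cycle length of \<open>g\<close>. The smallest cycle length of \<open>g\<close> is attained as such an
  order, except for the shapes 4A and 12A: there \<open>d\<close> is even because of the cycles of length 4, and so
  \<open>g ^ d\<close> is trivial because of those of length 2.
\<close>

section \<open>Tables and the evaluation of ground terms\<close>

text \<open>The group has more than two hundred million elements, so it cannot be listed. Exhibited
  elements prove transitivity, but they never bound a stabilizer from above, and this bound is the
  obstacle. It comes from the minimum weight: two words of weight 8 (octads) with five common points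
  differ by a word of weight at most 6, hence coincide. So an element fixing five points of an octad
  preserves the octad, and enough preserved octads leave only the identity.

  A cycle shape need not determine a conjugacy class. For most shapes this is harmless, since order,
  thread and the bound on the order of a common power are read off from the shape. Conjugacy has to
  be established only where a class must be recognised: for 2B, 3B, 4C and 6B, because an element
  known only by its shape has to be a power of some element of shape 12B, and for 4A and 12A,
  because the claim counts these as two single classes.\<close>

declare One_nat_def [simp del]

datatype table = Table "nat list"

fun entry :: "table \<Rightarrow> nat \<Rightarrow> nat" where
  "entry (Table xs) x = (if x \<in> {1..24} then xs ! (x - 1) else x)"

text \<open>Instantiated with \<open>reflexive\<close>, these become rewrite rules for literal
  tables: a lookup is a single matching step instead of a recursion over the list.\<close>

lemma entry_of_Table:
  assumes "t \<equiv> Table [a1, a2, a3, a4, a5, a6, a7, a8, a9, a10, a11, a12,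
    a13, a14, a15, a16, a17, a18, a19, a20, a21, a22, a23, a24]"
  shows "entry t 1 = a1" "entry t 2 = a2" "entry t 3 = a3" "entry t 4 = a4"
    "entry t 5 = a5" "entry t 6 = a6" "entry t 7 = a7" "entry t 8 = a8"
    "entry t 9 = a9" "entry t 10 = a10" "entry t 11 = a11" "entry t 12 = a12"
    "entry t 13 = a13" "entry t 14 = a14" "entry t 15 = a15" "entry t 16 = a16"
    "entry t 17 = a17" "entry t 18 = a18" "entry t 19 = a19" "entry t 20 = a20"
    "entry t 21 = a21" "entry t 22 = a22" "entry t 23 = a23" "entry t 24 = a24"
  unfolding assms by simp_all

text \<open>
  Together with \<open>if_weak_cong\<close>, the congruence rules below keep the simplifier from
  descending into tables and into the bodies of abstractions, which would otherwise be
  unfolded symbolically.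
\<close>

lemma Table_cong: "Table xs = Table xs"
  by (rule refl)

text \<open>Conditionals instead of connectives stop the evaluation at the first decisive element,
  since \<open>if_weak_cong\<close> leaves the branches alone until the condition is
  decided.\<close>

fun all_in :: "'a list \<Rightarrow> ('a \<Rightarrow> bool) \<Rightarrow> bool" where
  "all_in [] P = True"
| "all_in (x # xs) P = (if P x then all_in xs P else False)"

fun some_in :: "'a list \<Rightarrow> ('a \<Rightarrow> bool) \<Rightarrow> bool" where
  "some_in [] P = False"
| "some_in (x # xs) P = (if P x then True else some_in xs P)"

fun mem :: "'a \<Rightarrow> 'a list \<Rightarrow> bool" where
  "mem x [] = False"
| "mem x (y # ys) = (if x = y then True else mem x ys)"

lemma all_in_iff: "all_in xs P \<longleftrightarrow> (\<forall>x \<in> set xs. P x)"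
  by (induction xs) auto

lemma some_in_iff: "some_in xs P \<longleftrightarrow> (\<exists>x \<in> set xs. P x)"
  by (induction xs) auto

lemma mem_iff: "mem x xs \<longleftrightarrow> x \<in> set xs"
  by (induction xs) auto

lemma all_in_cong: "xs = ys \<Longrightarrow> all_in xs P = all_in ys P"
  by simp

lemma some_in_cong: "xs = ys \<Longrightarrow> some_in xs P = some_in ys P"
  by simp

lemma map_weak_cong: "xs = ys \<Longrightarrow> map f xs = map f ys"
  by simp

definition points :: "nat list" where
  "points = [1, 2, 3, 4, 5, 6, 7, 8, 9, 10, 11, 12, 13, 14, 15, 16, 17, 18, 19, 20, 21, 22, 23, 24]"

lemma set_points: "set points = {1..24}"
proof -
  have "points = [1..<Suc 24]"
    by (simp add: points_def upt_conv_Cons)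
  then show ?thesis
    by (metis set_upt atLeastLessThanSuc_atLeastAtMost)
qed

lemmas eval_congs = if_weak_cong Table_cong all_in_cong some_in_cong map_weak_cong

lemmas eval_simps = entry_of_Table[OF reflexive] all_in.simps some_in.simps mem.simps list.map
 comp_apply
  simp_thms if_True if_False rel_simps arith_simps one_add_one numeral_plus_one one_plus_numeral
  refl

section \<open>The Golay code as the kernel of a syndrome map\<close>

text \<open>The columns of a parity check matrix as 12-bit numbers. The points 13 to 24 carry the
  unit vectors; for \<open>i\<close> up to 12 the number encodes the part of the \<open>i\<close>-th
  word of \<open>basis\<close> inside 13 to 24, so that every basis word has syndrome 0.\<close>

definition syndrome_table :: table where
  "syndrome_table = Table
    [3189, 1183, 3403, 1763, 2483, 2918, 3788, 493, 986, 1972, 2845, 3642, 1, 2, 4, 8, 16, 32, 64,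
     128, 256, 512, 1024, 2048]"

abbreviation syn :: "nat \<Rightarrow> nat" where
  "syn \<equiv> entry syndrome_table"

fun syndrome :: "nat list \<Rightarrow> nat" where
  "syndrome [] = 0"
| "syndrome (x # xs) = xor (syn x) (syndrome xs)"

definition syndrome_kernel :: "nat set set" where
  "syndrome_kernel = {C. C \<subseteq> {1..24} \<and> (\<forall>k. even (card {x \<in> C. bit (syn x) k}))}"

lemma bit_syndrome:
  "distinct xs \<Longrightarrow> bit (syndrome xs) k \<longleftrightarrow> odd (card {x \<in> set xs. bit (syn x) k})"
proof (induction xs)
  case (Cons a xs)
  have "{x \<in> set (a # xs). bit (syn x) k} =
      (if bit (syn a) k then insert a {x \<in> set xs. bit (syn x) k}
       else {x \<in> set xs. bit (syn x) k})"
    by auto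
  with Cons show ?case
    by (simp add: bit_xor_iff)
qed simp

lemma syndrome_kernel_iff:
  assumes "distinct xs" "set xs \<subseteq> {1..24}"
  shows "set xs \<in> syndrome_kernel \<longleftrightarrow> syndrome xs = 0"
proof -
  have "syndrome xs = 0 \<longleftrightarrow> (\<forall>k. \<not> bit (syndrome xs) k)"
    by (auto intro: bit_eqI)
  with assms show ?thesis
    by (simp add: syndrome_kernel_def bit_syndrome)
qed

lemma even_card_sym_diff:
  assumes "finite A" "finite B"
  shows "even (card (sym_diff A B)) \<longleftrightarrow> (even (card A) \<longleftrightarrow> even (card B))"
proof -
  have "card (sym_diff A B) = card (A - B) + card (B - A)"
    using assms by (intro card_Un_disjoint) auto
  moreover have "card A = card (A - B) + card (A \<inter> B)" "card B = card (B - A) + card (A \<inter> B)"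
    using assms by (metis add.commute card_Int_Diff Int_commute)+
  ultimately show ?thesis by (simp, blast)
qed

lemma sym_diff_kernel:
  assumes "A \<in> syndrome_kernel" "B \<in> syndrome_kernel"
  shows "sym_diff A B \<in> syndrome_kernel"
proof -
  have "finite A" "finite B"
    using assms by (auto simp: syndrome_kernel_def intro: finite_subset)
  moreover have "{x \<in> sym_diff A B. bit (syn x) k} =
      sym_diff {x \<in> A. bit (syn x) k} {x \<in> B. bit (syn x) k}" for k
    by auto
  ultimately show ?thesis
    using assms by (auto simp: syndrome_kernel_def even_card_sym_diff)
qed

text \<open>\<open>numeral_xor_num\<close> matches only terms of the form \<open>numeral _\<close>,
  which 0 and 1 do not have.\<close>

lemma xor_one_zero:
  "xor (numeral m :: nat) 1 = xor (numeral m) (numeral num.One)"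
  "xor (1 :: nat) (numeral m) = xor (numeral num.One) (numeral m)"
  "xor (1 :: nat) 1 = 0" "xor (x :: nat) 0 = x" "xor (0 :: nat) x = x"
  by simp_all

lemmas syndrome_simps = syndrome.simps syndrome_table_def numeral_xor_num xor_num.simps
  option.simps xor_one_zero

section \<open>The generators of the code as explicit lists\<close>

definition nonresidues :: "nat list" where
  "nonresidues = [5, 7, 10, 11, 14, 15, 17, 19, 20, 21, 22]"

lemma QuadRes_23_iff: "QuadRes 23 a \<longleftrightarrow> nat (a mod 23) \<notin> set nonresidues"
proof
  assume "QuadRes 23 a"
  then obtain y where "[y ^ 2 = a] (mod 23)" by (auto simp: QuadRes_def)
  define r where "r = nat (y mod 23)"
  have "r < 23"
    by (simp add: r_def nat_less_iff)
  then have "r \<in> set (0 # points)"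
    by (auto simp: set_points)
  moreover have "\<forall>r \<in> set (0 # points). r ^ 2 mod 23 \<notin> set nonresidues"
    by (simp add: points_def nonresidues_def)
  moreover have "a mod 23 = (y mod 23) ^ 2 mod 23"
    using \<open>[y ^ 2 = a] (mod 23)\<close> by (simp add: cong_def power_mod)
  then have "a mod 23 = int (r ^ 2 mod 23)"
    by (simp add: r_def zmod_int)
  ultimately show "nat (a mod 23) \<notin> set nonresidues" by (metis nat_int)
next
  define r where "r = nat (a mod 23)"
  assume "nat (a mod 23) \<notin> set nonresidues"
  then have "r \<notin> set nonresidues" by (simp add: r_def)
  moreover have "r < 23"
    by (simp add: r_def nat_less_iff)
  then have "r \<in> set (0 # points)" "r \<noteq> 23" "r \<noteq> 24"
    by (auto simp: set_points)
  \<comment> \<open>Since 23 is 3 modulo 4, a root of a residue \<open>r\<close> is \<open>r ^ ((23 + 1) div 4)\<close>.\<close>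
  moreover have "\<forall>r \<in> set (0 # points).
      r \<in> set nonresidues \<or> r = 23 \<or> r = 24 \<or> (r ^ 6) ^ 2 mod 23 = r"
    by (simp add: points_def nonresidues_def)
  ultimately have "(r ^ 6) ^ 2 mod 23 = r" by blast
  then have "int ((r ^ 6) ^ 2 mod 23) = a mod 23" by (simp add: r_def)
  then have "[(int r ^ 6) ^ 2 = a] (mod 23)" by (simp add: cong_def zmod_int)
  then show "QuadRes 23 a" unfolding QuadRes_def by blast
qed

text \<open>For indices and points in 1 to 23 and \<open>r\<close> below 23, the two equations are
  the only ways in which \<open>x - i\<close> can be congruent to \<open>r\<close> modulo 23; no
  reduction has to be evaluated. The point 24 is infinity.\<close>

definition in_generator :: "nat \<Rightarrow> nat \<Rightarrow> bool" where
  "in_generator i x \<longleftrightarrow> x = 24 \<or> some_in nonresidues (\<lambda>r. x = i + r \<or> x + 23 = i + r)"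

lemma golay_generator_iff:
  assumes "i \<in> {1..23}" "x \<in> {1..24}"
  shows "x \<in> golay_generator i \<longleftrightarrow> in_generator i x"
proof (cases "x = 24")
  case False
  have "nat ((int x - int i) mod 23) = r \<longleftrightarrow> x = i + r \<or> x + 23 = i + r" if "r < 23" for r
  proof -
    have "(int x - int i) mod 23 = (if i \<le> x then int x - int i else int x - int i + 23)"
      using assms False mod_pos_pos_trivial[of "int x - int i + 23" 23]
      by (auto simp: mod_pos_pos_trivial)
    then show ?thesis using assms that by (auto simp: nat_eq_iff)
  qed
  moreover have "\<forall>r \<in> set nonresidues. r < 23"
    by (simp add: nonresidues_def)
  ultimately show ?thesis
    using False assms
    by (auto simp: golay_generator_def in_generator_def QuadRes_23_iff some_in_iff)
qed (simp add: golay_generator_def in_generator_def)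

lemmas in_generator_simps = in_generator_def nonresidues_def

lemma golay_generator_eq:
  assumes "i \<in> {1..23}"
  shows "golay_generator i = set (filter (in_generator i) points)"
proof -
  have "golay_generator i \<subseteq> {1..24}" by (auto simp: golay_generator_def)
  with golay_generator_iff[OF assms] show ?thesis by (auto simp: set_points)
qed

lemma syndrome_generators:
  "all_in points (\<lambda>i. if i = 24 then True else syndrome (filter (in_generator i) points) = 0)"
  unfolding points_def
  by (simp only: filter.simps in_generator_simps syndrome_simps eval_simps cong: eval_congs)

lemma golay_generator_in_kernel:
  assumes "i \<in> {1..23}"
  shows "golay_generator i \<in> syndrome_kernel"
proof -
  have "distinct (filter (in_generator i) points)"
    unfolding points_def by (rule distinct_filter) simp
  moreover have "syndrome (filter (in_generator i) points) = 0"
    using syndrome_generators assms by (auto simp: all_in_iff set_points)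
  ultimately show ?thesis
    unfolding golay_generator_eq[OF assms]
    by (subst syndrome_kernel_iff) (auto simp: set_points)
qed

lemma golay_code_subset_kernel: "C \<in> golay_code \<Longrightarrow> C \<in> syndrome_kernel"
proof (induction rule: golay_code.induct)
  case zero
  show ?case by (simp add: syndrome_kernel_def)
next
  case (add C i)
  then show ?case by (intro sym_diff_kernel golay_generator_in_kernel)
qed

lemma sym_diff_golay_code:
  assumes "A \<in> golay_code" "B \<in> golay_code"
  shows "sym_diff A B \<in> golay_code"
  using assms(2)
proof induction
  case zero
  with assms show ?case by simp
next
  case (add C i)
  have "sym_diff A (sym_diff C (golay_generator i)) = sym_diff (sym_diff A C) (golay_generator i)"
    by blast
  with add show ?case using golay_code.add[of "sym_diff A C" i] by simp
qed

text \<open>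
  A basis of the code in echelon form: the \<open>i\<close>-th word meets \<open>{1..12}\<close> in \<open>i\<close> alone, and it is the
  sum of the generators whose indices are listed with it.
\<close>

definition basis :: "(nat list \<times> nat list) list" where
  "basis = [
    ([1, 13, 15, 17, 18, 19, 23, 24], [10, 13, 14]),
    ([2, 13, 14, 15, 16, 17, 20, 23], [1, 2, 8, 17]),
    ([3, 13, 14, 16, 19, 21, 23, 24], [15, 18, 23]),
    ([4, 13, 14, 18, 19, 20, 22, 23], [2, 6, 18, 19]),
    ([5, 13, 14, 17, 18, 20, 21, 24], [1, 8, 20]),
    ([6, 14, 15, 18, 19, 21, 22, 24], [2, 9, 21]),
    ([7, 15, 16, 19, 20, 22, 23, 24], [3, 10, 22]),
    ([8, 13, 15, 16, 18, 19, 20, 21], [1, 4, 5, 22]),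
    ([9, 14, 16, 17, 19, 20, 21, 22], [1, 3, 8, 13]),
    ([10, 15, 17, 18, 20, 21, 22, 23], [1, 3, 6, 7]),
    ([11, 13, 15, 16, 17, 21, 22, 24], [8, 11, 12]),
    ([12, 14, 16, 17, 18, 22, 23, 24], [9, 12, 13])]"

text \<open>Inequality of truth values is addition over the field with 2 elements.\<close>

fun in_sum :: "nat list \<Rightarrow> nat \<Rightarrow> bool" where
  "in_sum [] x = False"
| "in_sum (i # ks) x = (in_generator i x \<noteq> in_sum ks x)"

lemma sum_of_generators:
  assumes "set ks \<subseteq> {1..23}"
  shows "{x \<in> {1..24}. in_sum ks x} \<in> golay_code"
  using assms
proof (induction ks)
  case Nil
  show ?case by (simp add: golay_code.zero)
next
  case (Cons i ks)
  have "golay_generator i \<subseteq> {1..24}"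
    by (auto simp: golay_generator_def)
  then have "{x \<in> {1..24}. in_sum (i # ks) x} =
      sym_diff {x \<in> {1..24}. in_sum ks x} (golay_generator i)"
    using golay_generator_iff[of i] Cons.prems by auto
  with Cons show ?case by (simp add: golay_code.add)
qed

lemma basis_eq_sum:
  "all_in basis (\<lambda>(b, ks). all_in points (\<lambda>x. in_sum ks x = some_in b (\<lambda>y. y = x)))"
  unfolding basis_def points_def
  by (simp only: in_sum.simps in_generator_simps prod.case eval_simps cong: eval_congs)

lemma basis_in_golay_code:
  assumes "(b, ks) \<in> set basis"
  shows "set b \<in> golay_code"
proof -
  have "set ks \<subseteq> {1..23}" "set b \<subseteq> {1..24}"
    using assms unfolding basis_def list.set(2) by (elim insertE; simp)+
  moreover have "\<forall>x \<in> set points. in_sum ks x = (x \<in> set b)"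
    using basis_eq_sum assms by (auto simp: all_in_iff some_in_iff)
  ultimately have "{x \<in> {1..24}. in_sum ks x} = set b"
    by (auto simp: set_points)
  with sum_of_generators[OF \<open>set ks \<subseteq> {1..23}\<close>] show ?thesis by simp
qed

lemma syn_rest: "x \<in> {13..24} \<Longrightarrow> syn x = 2 ^ (x - 13)"
proof -
  have "all_in points (\<lambda>x. 12 < x \<longrightarrow> syn x * 2 ^ 13 = 2 ^ x)"
    unfolding points_def syndrome_table_def by simp
  moreover assume "x \<in> {13..24}"
  ultimately have "syn x * 2 ^ 13 = 2 ^ x"
    by (auto simp: all_in_iff set_points)
  also have "\<dots> = 2 ^ (x - 13) * 2 ^ 13"
    using \<open>x \<in> {13..24}\<close> power_add[of "2::nat" "x - 13" 13] by simp
  finally show ?thesis by simp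
qed

text \<open>The points 13 to 24 have distinct unit vectors as syndromes, so a point \<open>x\<close>
  of \<open>C\<close> would be the only one contributing to bit \<open>x - 13\<close>, and that bit
  would have odd count.\<close>

lemma kernel_disjoint:
  assumes "C \<in> syndrome_kernel" "C \<inter> {1..12} = {}"
  shows "C = {}"
proof (rule ccontr)
  assume "C \<noteq> {}"
  have C: "C \<subseteq> {13..24}"
    using assms by (fastforce simp: syndrome_kernel_def)
  obtain x where "x \<in> C" using \<open>C \<noteq> {}\<close> by auto
  have "{y \<in> C. bit (syn y) (x - 13)} = {x}"
  proof -
    have "13 \<le> y" "syn y = 2 ^ (y - 13)" if "y \<in> C" for y
      using C that by (auto intro!: syn_rest)
    then show ?thesis
      using \<open>x \<in> C\<close> by (auto simp: bit_exp_iff) (metis eq_diff_iff)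
  qed
  then have "card {y \<in> C. bit (syn y) (x - 13)} = 1" by simp
  with assms(1) show False
    by (auto simp: syndrome_kernel_def) (metis odd_one)
qed

lemma basis_pivot:
  assumes "i \<in> {1..12}"
  obtains b ks where "(b, ks) \<in> set basis" "set b \<inter> {1..12} = {i}"
proof -
  have "\<forall>(b, ks) \<in> set basis. set b \<inter> {1..12} = {hd b}"
    unfolding basis_def by simp
  moreover have "i \<in> set (map (hd \<circ> fst) basis)"
    using assms by (simp add: basis_def) presburger
  ultimately show thesis using that by fastforce
qed

text \<open>Gaussian elimination: adding the basis word with pivot \<open>i\<close> removes
  \<open>i\<close> from the part of \<open>C\<close> in 1 to 12 and changes nothing else there,
  until \<open>kernel_disjoint\<close> applies. All later claims about arbitrary codewords thereby
  reduce to the twelve basis words.\<close>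

lemma kernel_induct [consumes 1, case_names empty add]:
  assumes "C \<in> syndrome_kernel"
    and empty: "P {}"
    and add: "\<And>C b ks. C \<in> syndrome_kernel \<Longrightarrow> (b, ks) \<in> set basis \<Longrightarrow> P C \<Longrightarrow> P (sym_diff C (set b))"
  shows "P C"
  using assms(1)
proof (induction "card (C \<inter> {1..12})" arbitrary: C rule: less_induct)
  case less
  show ?case
  proof (cases "C \<inter> {1..12} = {}")
    case True
    with less.prems empty show ?thesis using kernel_disjoint by blast
  next
    case False
    then obtain i where i: "i \<in> C" "i \<in> {1..12}" by blast
    obtain b ks where b: "(b, ks) \<in> set basis" "set b \<inter> {1..12} = {i}"
      using basis_pivot[OF i(2)] .
    define D where "D = sym_diff C (set b)"
    have D: "D \<in> syndrome_kernel"
      unfolding D_def using less.prems golay_code_subset_kernel[OF basis_in_golay_code[OF b(1)]]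
      by (rule sym_diff_kernel)
    have "D \<inter> {1..12} = C \<inter> {1..12} - {i}"
    proof -
      have "x \<in> set b \<longleftrightarrow> x = i" if "x \<in> {1..12}" for x
        using b(2) that by (metis IntI Int_iff singleton_iff)
      with i show ?thesis unfolding D_def by (auto simp del: atLeastAtMost_iff)
    qed
    then have "card (D \<inter> {1..12}) < card (C \<inter> {1..12})"
      using i card_Diff1_less[of "C \<inter> {1..12}" i] by simp
    with D have "P D" using less.hyps by blast
    then have "P (sym_diff D (set b))" using add D b(1) by blast
    moreover have "sym_diff D (set b) = C" unfolding D_def by blast
    ultimately show ?thesis by simp
  qed
qed

lemma golay_code_eq_kernel: "golay_code = syndrome_kernel"
proof (intro equalityI subsetI)
  fix C assume "C \<in> syndrome_kernel"
  then show "C \<in> golay_code"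
    by (induction rule: kernel_induct)
      (auto intro: golay_code.zero sym_diff_golay_code basis_in_golay_code)
qed (rule golay_code_subset_kernel)

lemma golay_code_subset: "C \<in> golay_code \<Longrightarrow> C \<subseteq> {1..24}"
  by (simp add: golay_code_eq_kernel syndrome_kernel_def)

lemma finite_golay_code: "finite golay_code"
proof (rule finite_subset)
  show "golay_code \<subseteq> Pow {1..24}"
    by (intro subsetI PowI golay_code_subset)
qed simp

lemma even_card_golay_code:
  assumes "C \<in> golay_code"
  shows "even (card C)"
  using assms unfolding golay_code_eq_kernel
proof (induction rule: kernel_induct)
  case (add C b ks)
  have "finite C" using add(1) by (auto simp: syndrome_kernel_def intro: finite_subset)
  moreover have "card (set b) = 8"
    using add(2) unfolding basis_def list.set(2) by (elim insertE) simp_all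
  ultimately show ?case using add(3) by (simp add: even_card_sym_diff)
qed simp

section \<open>The group\<close>

lemma carrier_M24:
  "p \<in> carrier M24 \<longleftrightarrow> p permutes {1..24} \<and> (\<forall>C \<in> golay_code. p ` C \<in> golay_code)"
  by (simp add: M24_def sym_group_carrier)

lemma mult_M24 [simp]: "g \<otimes>\<^bsub>M24\<^esub> h = g \<circ> h"
  by (simp add: M24_def sym_group_mult)

lemma one_M24 [simp]: "\<one>\<^bsub>M24\<^esub> = id"
  by (simp add: M24_def sym_group_one)

text \<open>\<open>M24\<close> only asks that codewords go to codewords. Since the code is finite,
  this injective map of the code into itself is onto, so the inverse preserves the code as
  well.\<close>

lemma inv_in_carrier_M24:
  assumes "p \<in> carrier M24"
  shows "inv' p \<in> carrier M24"
proof -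
  have p: "p permutes {1..24}" using assms by (simp add: carrier_M24)
  have "inj_on ((`) p) golay_code"
    using p by (metis inj_on_image inj_on_subset permutes_inj subset_UNIV)
  moreover have "(`) p ` golay_code \<subseteq> golay_code"
    using assms by (auto simp: carrier_M24)
  ultimately have "(`) p ` golay_code = golay_code"
    using finite_golay_code by (metis endo_inj_surj)
  then have "inv' p ` C \<in> golay_code" if "C \<in> golay_code" for C
    using that p by (metis (no_types, opaque_lifting) image_iff image_inv_f_f permutes_inj)
  with p show ?thesis by (simp add: carrier_M24 permutes_inv)
qed

lemma comp_in_carrier_M24: "p \<in> carrier M24 \<Longrightarrow> q \<in> carrier M24 \<Longrightarrow> p \<circ> q \<in> carrier M24"
  unfolding carrier_M24 by (metis image_comp permutes_compose)

lemma inv_comp_M24: "p \<in> carrier M24 \<Longrightarrow> inv' p \<circ> p = id"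
  unfolding carrier_M24 by (blast intro: permutes_inv_o)

interpretation M24: group M24
proof (rule groupI)
  show "\<one>\<^bsub>M24\<^esub> \<in> carrier M24" by (simp add: carrier_M24 permutes_id)
  show "\<exists>q \<in> carrier M24. q \<otimes>\<^bsub>M24\<^esub> p = \<one>\<^bsub>M24\<^esub>" if "p \<in> carrier M24" for p
    using that by (intro bexI[of _ "inv' p"]) (simp_all add: inv_in_carrier_M24 inv_comp_M24)
qed (auto simp: comp_in_carrier_M24 comp_assoc)

lemma inv_M24: "p \<in> carrier M24 \<Longrightarrow> inv\<^bsub>M24\<^esub> p = inv' p"
  by (rule M24.inv_equality) (simp_all add: inv_in_carrier_M24 inv_comp_M24)

lemma pow_M24: "p [^]\<^bsub>M24\<^esub> (n::nat) = p ^^ n"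
  by (induction n) (simp_all add: funpow_Suc_right del: funpow.simps(2))

lemma funpow_in_carrier_M24: "p \<in> carrier M24 \<Longrightarrow> (p ^^ n) \<in> carrier M24"
  using M24.nat_pow_closed[of p n] by (simp add: pow_M24)

lemma finite_M24: "finite (carrier M24)"
  by (rule finite_subset[of _ "{p. p permutes {1..24}}"]) (auto simp: carrier_M24
   finite_permutations)

text \<open>Surjectivity is enough for a permutation of a finite set, and by linearity the images of
  the basis words decide for the whole code.\<close>

definition preserves_code :: "table \<Rightarrow> bool" where
  "preserves_code t \<longleftrightarrow>
     all_in points (\<lambda>y. some_in points (\<lambda>x. entry t x = y)) \<and>
     all_in basis (\<lambda>(b, ks). syndrome (map (entry t) b) = 0)"

lemma entry_outside: "x \<notin> {1..24} \<Longrightarrow> entry t x = x"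
  by (cases t) auto

lemma preserves_code_in_M24:
  assumes "preserves_code t"
  shows "entry t \<in> carrier M24"
proof -
  define p where "p = entry t"
  have "{1..24} \<subseteq> p ` {1..24}"
  proof
    fix y :: nat assume "y \<in> {1..24}"
    then have "\<exists>x \<in> {1..24}. p x = y"
      using assms unfolding preserves_code_def all_in_iff some_in_iff set_points p_def by (metis (no_types))
    then show "y \<in> p ` {1..24}" by (metis image_eqI)
  qed
  then have "p ` {1..24} = {1..24}"
    by (metis card_image_le card_seteq finite_atLeastAtMost finite_imageI)
  then have "bij_betw p {1..24} {1..24}"
    by (simp add: bij_betw_def eq_card_imp_inj_on)
  then have p: "p permutes {1..24}"
    by (rule bij_imp_permutes) (unfold p_def, erule entry_outside)
  have b: "p ` set b \<in> golay_code" if "(b, ks) \<in> set basis" for b ks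
  proof -
    have "distinct b" "set b \<subseteq> {1..24}"
      using that unfolding basis_def list.set(2) by (elim insertE; simp)+
    then have "distinct (map p b)" "set (map p b) \<subseteq> {1..24}"
      using permutes_image[OF p] permutes_inj_on[OF p] by (auto simp: distinct_map)
    moreover have "syndrome (map p b) = 0"
      using assms that by (auto simp: preserves_code_def all_in_iff p_def)
    ultimately have "set (map p b) \<in> golay_code"
      by (simp only: golay_code_eq_kernel syndrome_kernel_iff)
    then show ?thesis by simp
  qed
  have "p ` C \<in> golay_code" if "C \<in> syndrome_kernel" for C
    using that
  proof (induction rule: kernel_induct)
    case (add C c ks)
    have "p ` sym_diff C (set c) = sym_diff (p ` C) (p ` set c)"
      using permutes_inj[OF p] by (simp add: image_Un image_set_diff)
    with add b show ?case by (simp add: sym_diff_golay_code)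
  qed (simp add: golay_code.zero)
  with p show ?thesis
    by (simp add: carrier_M24 golay_code_eq_kernel p_def)
qed

section \<open>Transitivity and the stabilizer of five points\<close>

text \<open>
  The first entry is \<open>x \<mapsto> -1/x\<close>, the second \<open>x \<mapsto> x + 1\<close>, the third \<open>x \<mapsto> 2x\<close>; the other two
  were found by a search among the elements fixing 24, 23, 19, and 24, 23, 19, 18, respectively.
\<close>

definition generators :: "table list" where
  "generators = [
    Table [22, 11, 15, 17, 9, 19, 13, 20, 5, 16, 2, 21, 7, 18, 3, 10, 4, 14, 6, 8, 12, 1, 24, 23],
    Table [2, 3, 4, 5, 6, 7, 8, 9, 10, 11, 12, 13, 14, 15, 16, 17, 18, 19, 20, 21, 22, 23, 1, 24],
    Table [2, 4, 6, 8, 10, 12, 14, 16, 18, 20, 22, 1, 3, 5, 7, 9, 11, 13, 15, 17, 19, 21, 23, 24],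
    Table [8, 7, 9, 14, 6, 3, 12, 21, 15, 4, 22, 18, 2, 11, 5, 16, 20, 13, 19, 1, 17, 10, 23, 24],
    Table [12, 7, 14, 2, 13, 3, 17, 10, 16, 11, 15, 6, 9, 1, 21, 22, 20, 18, 19, 4, 8, 5, 23, 24]]"

definition base :: "nat list" where
  "base = [24, 23, 19, 18, 17]"

text \<open>
  The pointwise stabilizer of the base. The base lies in the octad 24, 23, 19, 18, 17, 15, 13, 1; the
  orbits of the stabilizer on the other points are the rest of that octad, represented by 15, and the
  complement of the octad, represented by 22.
\<close>

definition stab5 :: "table list" where
  "stab5 = [
    Table [1, 2, 3, 4, 5, 6, 7, 8, 9, 10, 11, 12, 13, 14, 15, 16, 17, 18, 19, 20, 21, 22, 23, 24],
    Table [1, 9, 12, 5, 4, 14, 8, 7, 2, 20, 16, 3, 13, 6, 15, 11, 17, 18, 19, 10, 22, 21, 23, 24],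
    Table [1, 12, 9, 14, 6, 5, 16, 11, 3, 21, 8, 2, 13, 4, 15, 7, 17, 18, 19, 22, 10, 20, 23, 24],
    Table [1, 4, 6, 2, 9, 3, 20, 10, 5, 8, 21, 14, 13, 12, 15, 22, 17, 18, 19, 7, 11, 16, 23, 24],
    Table [1, 7, 11, 20, 10, 21, 2, 9, 8, 5, 3, 16, 13, 22, 15, 12, 17, 18, 19, 4, 6, 14, 23, 24],
    Table [1, 20, 21, 7, 8, 11, 4, 5, 10, 9, 6, 22, 13, 16, 15, 14, 17, 18, 19, 2, 3, 12, 23, 24],
    Table [1, 5, 14, 9, 2, 12, 10, 20, 4, 7, 22, 6, 13, 3, 15, 21, 17, 18, 19, 8, 16, 11, 23, 24],
    Table [1, 3, 2, 6, 14, 4, 11, 16, 12, 22, 7, 9, 13, 5, 15, 8, 17, 18, 19, 21, 20, 10, 23, 24],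
    Table [1, 21, 20, 11, 16, 7, 6, 14, 22, 12, 4, 10, 13, 8, 15, 5, 17, 18, 19, 3, 2, 9, 23, 24],
    Table [1, 6, 4, 3, 12, 2, 21, 22, 14, 16, 20, 5, 13, 9, 15, 10, 17, 18, 19, 11, 7, 8, 23, 24],
    Table [1, 14, 5, 12, 3, 9, 22, 21, 6, 11, 10, 4, 13, 2, 15, 20, 17, 18, 19, 16, 8, 7, 23, 24],
    Table [1, 8, 16, 10, 20, 22, 9, 2, 7, 4, 12, 11, 13, 21, 15, 3, 17, 18, 19, 5, 14, 6, 23, 24],
    Table [1, 11, 7, 21, 22, 20, 3, 12, 16, 14, 2, 8, 13, 10, 15, 9, 17, 18, 19, 6, 4, 5, 23, 24],
    Table [1, 16, 8, 22, 21, 10, 12, 3, 11, 6, 9, 7, 13, 20, 15, 2, 17, 18, 19, 14, 5, 4, 23, 24],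
    Table [1, 10, 22, 8, 7, 16, 5, 4, 20, 2, 14, 21, 13, 11, 15, 6, 17, 18, 19, 9, 12, 3, 23, 24],
    Table [1, 22, 10, 16, 11, 8, 14, 6, 21, 3, 5, 20, 13, 7, 15, 4, 17, 18, 19, 12, 9, 2, 23, 24],
    Table [15, 3, 10, 21, 4, 9, 6, 20, 7, 2, 8, 14, 1, 16, 13, 12, 17, 18, 19, 11, 5, 22, 23, 24],
    Table [15, 12, 20, 22, 5, 2, 14, 10, 8, 9, 7, 6, 1, 11, 13, 3, 17, 18, 19, 16, 4, 21, 23, 24],
    Table [15, 9, 21, 10, 14, 3, 5, 22, 16, 12, 11, 4, 1, 7, 13, 2, 17, 18, 19, 8, 6, 20, 23, 24],
    Table [15, 6, 8, 11, 2, 5, 3, 7, 20, 4, 10, 12, 1, 22, 13, 14, 17, 18, 19, 21, 9, 16, 23, 24],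
    Table [15, 11, 5, 6, 20, 8, 21, 4, 2, 7, 9, 22, 1, 12, 13, 16, 17, 18, 19, 3, 10, 14, 23, 24],
    Table [15, 21, 9, 3, 7, 10, 11, 2, 4, 20, 5, 16, 1, 14, 13, 22, 17, 18, 19, 6, 8, 12, 23, 24],
    Table [15, 14, 7, 16, 9, 4, 12, 8, 10, 5, 20, 3, 1, 21, 13, 6, 17, 18, 19, 22, 2, 11, 23, 24],
    Table [15, 2, 22, 20, 6, 12, 4, 21, 11, 3, 16, 5, 1, 8, 13, 9, 17, 18, 19, 7, 14, 10, 23, 24],
    Table [15, 20, 12, 2, 11, 22, 7, 3, 6, 21, 14, 8, 1, 5, 13, 10, 17, 18, 19, 4, 16, 9, 23, 24],
    Table [15, 4, 16, 7, 3, 14, 2, 11, 21, 6, 22, 9, 1, 10, 13, 5, 17, 18, 19, 20, 12, 8, 23, 24],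
    Table [15, 5, 11, 8, 12, 6, 9, 16, 22, 14, 21, 2, 1, 20, 13, 4, 17, 18, 19, 10, 3, 7, 23, 24],
    Table [15, 16, 4, 14, 10, 7, 22, 5, 9, 8, 2, 21, 1, 3, 13, 11, 17, 18, 19, 12, 20, 6, 23, 24],
    Table [15, 7, 14, 4, 21, 16, 20, 6, 3, 11, 12, 10, 1, 9, 13, 8, 17, 18, 19, 2, 22, 5, 23, 24],
    Table [15, 8, 6, 5, 22, 11, 10, 14, 12, 16, 3, 20, 1, 2, 13, 7, 17, 18, 19, 9, 21, 4, 23, 24],
    Table [15, 22, 2, 12, 8, 20, 16, 9, 5, 10, 4, 11, 1, 6, 13, 21, 17, 18, 19, 14, 7, 3, 23, 24],
    Table [15, 10, 3, 9, 16, 21, 8, 12, 14, 22, 6, 7, 1, 4, 13, 20, 17, 18, 19, 5, 11, 2, 23, 24],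
    Table [13, 10, 2, 5, 21, 7, 9, 11, 6, 3, 20, 16, 15, 12, 1, 14, 17, 18, 19, 8, 4, 22, 23, 24],
    Table [13, 20, 9, 4, 22, 8, 2, 16, 14, 12, 10, 11, 15, 3, 1, 6, 17, 18, 19, 7, 5, 21, 23, 24],
    Table [13, 21, 12, 6, 10, 16, 3, 8, 5, 9, 22, 7, 15, 2, 1, 4, 17, 18, 19, 11, 14, 20, 23, 24],
    Table [13, 8, 4, 9, 11, 20, 5, 21, 3, 6, 7, 22, 15, 14, 1, 12, 17, 18, 19, 10, 2, 16, 23, 24],
    Table [13, 5, 7, 10, 6, 2, 8, 3, 21, 11, 4, 12, 15, 16, 1, 22, 17, 18, 19, 9, 20, 14, 23, 24],
    Table [13, 9, 20, 8, 3, 4, 10, 6, 11, 21, 2, 14, 15, 22, 1, 16, 17, 18, 19, 5, 7, 12, 23, 24],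
    Table [13, 7, 5, 2, 16, 10, 4, 22, 12, 14, 8, 21, 15, 6, 1, 3, 17, 18, 19, 20, 9, 11, 23, 24],
    Table [13, 22, 3, 14, 20, 11, 12, 7, 4, 2, 21, 8, 15, 9, 1, 5, 17, 18, 19, 16, 6, 10, 23, 24],
    Table [13, 12, 21, 16, 2, 6, 22, 4, 7, 20, 3, 5, 15, 10, 1, 8, 17, 18, 19, 14, 11, 9, 23, 24],
    Table [13, 16, 6, 12, 7, 21, 14, 20, 2, 4, 11, 10, 15, 5, 1, 9, 17, 18, 19, 22, 3, 8, 23, 24],
    Table [13, 11, 14, 3, 8, 22, 6, 10, 9, 5, 16, 20, 15, 4, 1, 2, 17, 18, 19, 21, 12, 7, 23, 24],
    Table [13, 4, 8, 20, 14, 9, 7, 12, 22, 16, 5, 3, 15, 11, 1, 21, 17, 18, 19, 2, 10, 6, 23, 24],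
    Table [13, 14, 11, 22, 4, 3, 16, 2, 20, 7, 6, 9, 15, 8, 1, 10, 17, 18, 19, 12, 21, 5, 23, 24],
    Table [13, 6, 16, 21, 5, 12, 11, 9, 10, 8, 14, 2, 15, 7, 1, 20, 17, 18, 19, 3, 22, 4, 23, 24],
    Table [13, 2, 10, 7, 12, 5, 20, 14, 16, 22, 9, 6, 15, 21, 1, 11, 17, 18, 19, 4, 8, 3, 23, 24],
    Table [13, 3, 22, 11, 9, 14, 21, 5, 8, 10, 12, 4, 15, 20, 1, 7, 17, 18, 19, 6, 16, 2, 23, 24]]"

lemma preserves_code_generators: "all_in generators preserves_code"
  unfolding generators_def
  by (simp only: preserves_code_def basis_def points_def prod.case syndrome_simps eval_simps
    cong: eval_congs)

lemma preserves_code_stab5: "all_in stab5 preserves_code"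
  unfolding stab5_def
  by (simp only: preserves_code_def basis_def points_def prod.case syndrome_simps eval_simps
    cong: eval_congs)

lemma generators_in_M24: "t \<in> set generators \<Longrightarrow> entry t \<in> carrier M24"
  using preserves_code_generators by (auto simp: all_in_iff intro: preserves_code_in_M24)

lemma stab5_in_M24: "t \<in> set stab5 \<Longrightarrow> entry t \<in> carrier M24"
  using preserves_code_stab5 by (auto simp: all_in_iff intro: preserves_code_in_M24)

lemma stab5_fixes: "all_in stab5 (\<lambda>s. all_in base (\<lambda>x. entry s x = x))"
  unfolding stab5_def base_def by (simp only: eval_simps cong: eval_congs)

text \<open>No orbit is searched for: \<open>ys\<close> is given in an order in which a single
  element fixing \<open>F\<close> takes each \<open>y\<close> to a point already linked with the
  start.\<close>

fun reachable :: "table list \<Rightarrow> nat list \<Rightarrow> nat list \<Rightarrow> nat list \<Rightarrow> bool" where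
  "reachable gs F seen [] = True"
| "reachable gs F seen (y # ys) =
     (if some_in gs (\<lambda>g. if mem (entry g y) seen then all_in F (\<lambda>x. entry g x = x) else False)
      then reachable gs F (y # seen) ys else False)"

lemma reachableD:
  assumes "reachable gs F seen ys" "\<And>g. g \<in> set gs \<Longrightarrow> entry g \<in> carrier M24"
    and "\<And>z. z \<in> set seen \<Longrightarrow> \<exists>c \<in> carrier M24. (\<forall>x \<in> set F. c x = x) \<and> c z = p"
    and "z \<in> set ys"
  shows "\<exists>c \<in> carrier M24. (\<forall>x \<in> set F. c x = x) \<and> c z = p"
  using assms
proof (induction ys arbitrary: seen)
  case (Cons y ys)
  then obtain g where g: "g \<in> set gs" "entry g y \<in> set seen" "\<forall>x \<in> set F. entry g x = x"
    and ys: "reachable gs F (y # seen) ys"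
    by (auto simp: some_in_iff all_in_iff mem_iff split: if_splits)
  then obtain c where c: "c \<in> carrier M24" "\<forall>x \<in> set F. c x = x" "c (entry g y) = p"
    using Cons.prems(3) by blast
  have "\<exists>c \<in> carrier M24. (\<forall>x \<in> set F. c x = x) \<and> c y = p"
    using c g Cons.prems(2) by (intro bexI[of _ "c \<circ> entry g"]) (auto intro:
     comp_in_carrier_M24)
  then show ?case
    using Cons.IH[OF ys] Cons.prems by auto
qed simp

definition orbit_chains :: "(nat list \<times> nat \<times> nat list) list" where
  "orbit_chains = [
    ([], 24, [23, 22, 21, 20, 19, 18, 17, 16, 15, 14, 13, 12, 11, 10, 9, 8, 7, 6, 5, 4, 3, 2, 1]),
    ([24], 23, [22, 21, 20, 19, 18, 17, 16, 15, 14, 13, 12, 11, 10, 9, 8, 7, 6, 5, 4, 3, 2, 1]),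
    ([24, 23], 19, [21, 20, 17, 16, 15, 14, 13, 12, 11, 10, 9, 8, 7, 6, 5, 4, 3, 2, 1, 22, 18]),
    ([24, 23, 19], 18, [12, 11, 10, 9, 8, 7, 6, 5, 4, 3, 2, 1, 22, 21, 20, 17, 16, 15, 14, 13]),
    ([24, 23, 19, 18], 17, [7, 6, 5, 4, 3, 2, 22, 21, 20, 16, 15, 14, 13, 12, 11, 10, 9, 8, 1])]"

lemma orbit_chains_reachable:
  "all_in orbit_chains (\<lambda>(F, p, ys). reachable (generators @ stab5) F [p] ys)"
  unfolding orbit_chains_def generators_def stab5_def append.simps
  by (simp only: reachable.simps prod.case eval_simps cong: eval_congs)

lemma stabilizer_transitive:
  assumes "n < 5" "y \<in> {1..24}" "y \<notin> set (take n base)"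
  obtains d where "d \<in> carrier M24" "\<forall>x \<in> set (take n base). d x = x" "d y = base ! n"
proof -
  have "n \<in> set [0, 1, 2, 3, 4]" using \<open>n < 5\<close> by auto
  then have "\<exists>ys. (take n base, base ! n, ys) \<in> set orbit_chains \<and>
      set points \<subseteq> set (take n base) \<union> set (base ! n # ys)"
    unfolding list.set(2)
    by (elim insertE) (simp_all add: base_def orbit_chains_def points_def One_nat_def)
  then obtain ys where ys: "(take n base, base ! n, ys) \<in> set orbit_chains"
    "set points \<subseteq> set (take n base) \<union> set (base ! n # ys)" by blast
  have start: "\<exists>c \<in> carrier M24. (\<forall>x \<in> set (take n base). c x = x) \<and> c z = base ! n"
    if "z \<in> set [base ! n]" for z
    using that M24.one_closed by (intro bexI[of _ id]) auto
  have closed: "entry g \<in> carrier M24" if "g \<in> set (generators @ stab5)" for g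
    using that generators_in_M24 stab5_in_M24 by (metis Un_iff set_append)
  have "reachable (generators @ stab5) (take n base) [base ! n] ys"
    using ys(1) orbit_chains_reachable by (auto simp: all_in_iff)
  note chain = reachableD[OF this closed start]
  have "y \<in> set ys \<or> y = base ! n"
    using assms ys(2) unfolding set_points by (metis UnE set_ConsD subsetD)
  then have "\<exists>c \<in> carrier M24. (\<forall>x \<in> set (take n base). c x = x) \<and> c y = base ! n"
    using chain start[of y] by (metis list.set_intros(1))
  then show thesis using that by blast
qed

lemma in_points_M24: "g \<in> carrier M24 \<Longrightarrow> g x \<in> {1..24} \<longleftrightarrow> x \<in> {1..24}"
  unfolding carrier_M24 by (meson permutes_in_image)

lemma inj_M24: "g \<in> carrier M24 \<Longrightarrow> inj g"
  unfolding carrier_M24 by (meson permutes_inj)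

lemma base_length: "length base = 5"
  by (simp add: base_def)

text \<open>The points are placed one at a time. Once the first ones lie on an initial segment of
  \<open>base\<close>, an element fixing that segment takes the next point to the next
  place.\<close>

lemma five_transitive:
  assumes "distinct as" "set as \<subseteq> {1..24}" "length as \<le> 5"
  shows "\<exists>c \<in> carrier M24. map c as = take (length as) base"
  using assms
proof (induction as rule: rev_induct)
  case Nil
  then show ?case using M24.one_closed by auto
next
  case (snoc a as)
  then obtain c where c: "c \<in> carrier M24" "map c as = take (length as) base" by auto
  have "c a \<notin> set (map c as)"
    using snoc.prems inj_M24[OF c(1)] by (auto dest: injD)
  with c snoc.prems obtain d where d: "d \<in> carrier M24"
    "\<forall>x \<in> set (take (length as) base). d x = x" "d (c a) = base ! length as"
    using stabilizer_transitive[of "length as" "c a"] in_points_M24[OF c(1)] by auto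
  have "map (d \<circ> c) as = map d (map c as)" by simp
  also have "\<dots> = take (length as) base"
    unfolding c(2) using d(2) by (simp add: map_idI)
  finally have "map (d \<circ> c) (as @ [a]) = take (length (as @ [a])) base"
    using d(3) snoc.prems take_Suc_conv_app_nth[of "length as" base]
    by (simp add: base_length)
  with c d show ?case by (blast intro: comp_in_carrier_M24)
qed

lemma stab5_orbits:
  "all_in points (\<lambda>y. if mem y base then True
     else some_in stab5 (\<lambda>s. if entry s y = 15 then True else entry s y = 22))"
  unfolding points_def base_def stab5_def by (simp only: eval_simps cong: eval_congs)

text \<open>After \<open>as\<close> has been moved to \<open>base\<close>, an element of
  \<open>stab5\<close> moves the image of \<open>b\<close> without disturbing the base. The two
  outcomes tell whether \<open>b\<close> lies in the octad through \<open>as\<close> or outside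
  it.\<close>

lemma normalize_six_points:
  assumes "distinct (b # as)" "set (b # as) \<subseteq> {1..24}" "length as = 5"
  obtains c where "c \<in> carrier M24" "map c as = base" "c b = 15 \<or> c b = 22"
proof -
  obtain c where c: "c \<in> carrier M24" "map c as = base"
    using five_transitive[of as] assms by (auto simp: base_def)
  have "c b \<notin> set (map c as)"
    using assms inj_M24[OF c(1)] by (auto dest: injD)
  moreover have "c b \<in> {1..24}" using assms in_points_M24[OF c(1)] by auto
  ultimately obtain s where s: "s \<in> set stab5" "entry s (c b) = 15 \<or> entry s (c b) = 22"
    using stab5_orbits c(2) by (auto simp: all_in_iff some_in_iff mem_iff set_points split: if_splits)
  have "map (entry s \<circ> c) as = map (entry s) base"
    unfolding c(2)[symmetric] by simp
  also have "\<dots> = base"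
    using stab5_fixes s(1) by (simp add: all_in_iff map_idI)
  finally show thesis
    using that[of "entry s \<circ> c"] s c by (auto intro: comp_in_carrier_M24 stab5_in_M24)
qed

text \<open>Weights are even, so 2, 4 and 6 have to be excluded. Transitivity carries a word of such
  a weight to one of four explicit sets: the first two or four points of \<open>base\<close>, or
  \<open>base\<close> together with 15 or 22. Their syndromes are not 0.\<close>

lemma golay_code_min_weight:
  assumes "C \<in> golay_code" "C \<noteq> {}"
  shows "8 \<le> card C"
proof (rule ccontr)
  assume "\<not> 8 \<le> card C"
  have C: "finite C" "C \<subseteq> {1..24}"
    using golay_code_subset[OF assms(1)] finite_subset by auto
  then obtain as where as: "distinct as" "set as = C"
    using finite_distinct_list by blast
  then have len: "length as = card C" by (metis distinct_card)
  obtain m where m: "card C = 2 * m"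
    using even_card_golay_code[OF assms(1)] by (elim evenE)
  moreover have "card C \<noteq> 0" using assms(2) C(1) by simp
  ultimately have "m \<in> {1, 2, 3}"
    using \<open>\<not> 8 \<le> card C\<close> by auto
  then have "length as \<in> {2, 4, 6}"
    using len m by auto
  then consider "length as = 2" | "length as = 4" | b bs where "as = b # bs" "length bs = 5"
    by (cases as) auto
  then show False
  proof cases
    case 3
    then obtain c where c: "c \<in> carrier M24" "map c bs = base" "c b = 15 \<or> c b = 22"
      using normalize_six_points as C by metis
    have "set (map c as) \<in> golay_code"
      using c(1) as assms(1) by (auto simp: carrier_M24)
    then have "syndrome (c b # base) = 0"
      using as 3 c by (subst (asm) golay_code_eq_kernel, subst (asm) syndrome_kernel_iff)
        (auto simp: base_def)
    with c(3) show False
      by (elim disjE) (simp_all only: base_def syndrome_simps eval_simps zero_neq_numeral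
        numeral_neq_zero cong: eval_congs)
  next
    have *: "syndrome (take (length as) base) = 0" if "length as \<le> 5"
    proof -
      obtain c where c: "c \<in> carrier M24" "map c as = take (length as) base"
        using five_transitive[of as] as C \<open>length as \<le> 5\<close> by auto
      have "set (map c as) \<in> golay_code"
        using c(1) as assms(1) by (auto simp: carrier_M24)
      then have "set (take (length as) base) \<in> syndrome_kernel"
        unfolding c(2) golay_code_eq_kernel .
      moreover have "distinct (take (length as) base)" "set (take (length as) base) \<subseteq> {1..24}"
        using set_take_subset[of "length as" base] by (auto simp: base_def)
      ultimately show ?thesis using syndrome_kernel_iff by blast
    qed
    {
      case 1
      with * have "syndrome [24, 23] = 0" by (simp add: base_def)
      then show False
        by (simp only: syndrome_simps eval_simps zero_neq_numeral numeral_neq_zero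
          cong: eval_congs)
    next
      case 2
      with * have "syndrome [24, 23, 19, 18] = 0" by (simp add: base_def)
      then show False
        by (simp only: syndrome_simps eval_simps zero_neq_numeral numeral_neq_zero
          cong: eval_congs)
    }
  qed
qed

text \<open>\<open>B\<close> and its image share the five fixed points, so they differ in at most 3
  + 3 points, fewer than the minimum weight allows.\<close>

lemma octad_fixed:
  assumes "g \<in> carrier M24" "B \<in> golay_code" "card B = 8"
    and "F \<subseteq> B" "5 \<le> card F" "\<forall>x \<in> F. g x = x"
  shows "g ` B = B"
proof -
  have fin: "finite B" using assms(3) by (metis card.infinite zero_neq_numeral)
  have F: "F \<subseteq> g ` B"
    using assms(4,6) by (metis image_subset_iff image_ident subsetI image_eqI subsetD)
  have g: "card (g ` B) = 8"
    using assms(3) inj_M24[OF assms(1)] by (simp add: card_image inj_on_subset)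
  have "card (g ` B - B) \<le> card (g ` B - F)" "card (B - g ` B) \<le> card (B - F)"
    using fin assms(4) F by (auto intro!: card_mono)
  moreover have "card (g ` B - F) \<le> 3" "card (B - F) \<le> 3"
    using assms(3-5) F g fin by (simp_all add: card_Diff_subset finite_subset)
  moreover have "card (sym_diff (g ` B) B) = card (g ` B - B) + card (B - g ` B)"
    using fin by (intro card_Un_disjoint) auto
  moreover have "sym_diff (g ` B) B \<in> golay_code"
    using assms(1,2) by (intro sym_diff_golay_code) (auto simp: carrier_M24)
  ultimately have "sym_diff (g ` B) B = {}"
    using golay_code_min_weight[of "sym_diff (g ` B) B"] by linarith
  then show ?thesis by blast
qed

text \<open>Each of these codewords has five points among 15, 22 and the base, so every element
  fixing those seven points preserves it.\<close>

definition octads :: "nat list list" where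
  "octads = [
    [3, 11, 14, 15, 17, 19, 22, 23],
    [2, 4, 15, 16, 17, 18, 19, 22],
    [9, 10, 12, 15, 17, 19, 22, 24],
    [7, 15, 16, 19, 20, 22, 23, 24],
    [6, 14, 15, 18, 19, 21, 22, 24],
    [5, 8, 12, 15, 18, 19, 22, 23],
    [3, 5, 7, 15, 17, 18, 22, 24],
    [4, 5, 17, 19, 21, 22, 23, 24],
    [4, 9, 11, 15, 18, 22, 23, 24]]"

text \<open>The points 1 and 13 are exempt because such octads cannot tell them apart. An octad
  through 22 and four more of the seven points already meets the octad of the base in four points,
  the largest intersection of different octads, and so avoids both; an octad without 22 is that of
  the base and contains both.\<close>

lemma octads_separate:
  "all_in points (\<lambda>y. all_in points (\<lambda>z.
     if y = z \<or> mem y ([15, 22, 1, 13] @ base) \<or> mem z ([15, 22] @ base) then True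
     else some_in octads (\<lambda>b. mem y b \<noteq> mem z b)))"
  unfolding points_def base_def octads_def append.simps
  by (simp only: eval_simps cong: eval_congs)

lemma octad_fixed_list:
  assumes "g \<in> carrier M24" "syndrome b = 0" "distinct b" "length b = 8" "set b \<subseteq> {1..24}"
    and "5 \<le> length (filter P b)" "\<And>x. P x \<Longrightarrow> g x = x"
  shows "g ` set b = set b"
proof (rule octad_fixed[OF assms(1), of _ "set (filter P b)"])
  show "set b \<in> golay_code"
    using assms by (simp add: golay_code_eq_kernel syndrome_kernel_iff)
  show "5 \<le> card (set (filter P b))"
    using assms by (metis distinct_card distinct_filter)
qed (use assms in \<open>auto simp: distinct_card\<close>)

lemma syndrome_octads: "all_in octads (\<lambda>b. syndrome b = 0)"
  unfolding octads_def by (simp only: syndrome_simps eval_simps cong: eval_congs)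

lemma syndrome_two_octads: "syndrome [24, 23, 19, 18, 17, 15, 13, 1] = 0"
  "syndrome [2, 13, 14, 15, 16, 17, 20, 23] = 0"
  by (simp_all only: syndrome_simps eval_simps cong: eval_congs)

lemma seven_fixed_points:
  assumes g: "g \<in> carrier M24" and fixed: "\<forall>x \<in> set ([15, 22] @ base). g x = x"
  shows "g = id"
proof -
  have oct: "g ` set b = set b" if "b \<in> set octads" for b
  proof (rule octad_fixed_list[OF g, of b "\<lambda>x. x \<in> set ([15, 22] @ base)"])
    show "syndrome b = 0" using syndrome_octads that by (simp add: all_in_iff)
    show "distinct b" "length b = 8" "set b \<subseteq> {1..24}"
      "5 \<le> length (filter (\<lambda>x. x \<in> set ([15, 22] @ base)) b)"
      using that unfolding octads_def list.set(2) by (elim insertE; simp add: base_def)+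
  qed (use fixed in blast)
  have inj: "g x = g y \<longleftrightarrow> x = y" for x y using inj_M24[OF g] by (auto dest: injD)
  have most: "g y = y" if "y \<in> {1..24} - {1, 13}" for y
  proof (rule ccontr)
    assume "g y \<noteq> y"
    then have y: "y \<notin> set ([15, 22] @ base)" using fixed by blast
    have "y \<in> {1..24}" using that by blast
    then have "g y \<in> {1..24}" using in_points_M24[OF g] by blast
    with \<open>y \<in> {1..24}\<close> have "if y = g y \<or> y \<in> set ([15, 22, 1, 13] @
     base) \<or>
        g y \<in> set ([15, 22] @ base) then True
      else \<exists>b \<in> set octads. (y \<in> set b) \<noteq> (g y \<in> set b)"
      using octads_separate unfolding all_in_iff some_in_iff mem_iff set_points by (metis (no_types))
    moreover have "g y \<notin> set ([15, 22] @ base)"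
      using y fixed inj by metis
    moreover have "y \<notin> set ([15, 22, 1, 13] @ base)"
      using y that by auto
    ultimately obtain b where b: "b \<in> set octads" "y \<in> set b \<longleftrightarrow> g y \<notin> set b"
      using \<open>g y \<noteq> y\<close> by metis
    have "y \<in> set b \<longleftrightarrow> g y \<in> g ` set b" using inj by auto
    with b oct show False by simp
  qed
  \<comment> \<open>This octad contains 13 but not 1, and its other seven points are already known
    to be fixed. It separates the two points that were left over.\<close>
  have last: "g ` set [2, 13, 14, 15, 16, 17, 20, 23] = set [2, 13, 14, 15, 16, 17, 20, 23]"
    by (rule octad_fixed_list[OF g syndrome_two_octads(2), where P = "\<lambda>x. x \<in> {1..24}
     - {1, 13}"])
      (use most in \<open>simp_all\<close>)
  have "g 13 \<in> g ` set [2, 13, 14, 15, 16, 17, 20, 23]"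
    by (rule imageI) simp
  then have "g 13 \<noteq> 1" unfolding last by auto
  moreover have "g 13 \<in> {1, 13}"
  proof (rule ccontr)
    assume "g 13 \<notin> {1, 13}"
    then have "g (g 13) = g 13" using most in_points_M24[OF g, of 13] by auto
    with \<open>g 13 \<notin> {1, 13}\<close> show False using inj by auto
  qed
  ultimately have "g 13 = 13" by auto
  have "g 1 = 1"
  proof (rule ccontr)
    assume "g 1 \<noteq> 1"
    moreover have "g 1 \<noteq> 13" using inj \<open>g 13 = 13\<close> by (metis numeral_eq_one_iff semiring_norm(84))
    ultimately have "g (g 1) = g 1" using most in_points_M24[OF g, of 1] by auto
    with \<open>g 1 \<noteq> 1\<close> show False using inj by auto
  qed
  have "g y = y" for y
  proof (cases "y \<in> {1..24}")
    case True
    with most \<open>g 1 = 1\<close> \<open>g 13 = 13\<close> show ?thesis by blast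
  next
    case False
    with g show ?thesis unfolding carrier_M24 by (meson permutes_not_in)
  qed
  then show ?thesis by auto
qed

text \<open>An element fixing the base keeps 15 inside the octad of the base and 22 outside it,
  which leaves 3 times 16 pairs of images. The 48 tables realise all of them, so any such element
  agrees with some table at seven points.\<close>

lemma stab5_regular:
  "all_in [15, 13, 1] (\<lambda>a. all_in points (\<lambda>b.
     if mem b [24, 23, 19, 18, 17, 15, 13, 1] then True
     else some_in stab5 (\<lambda>s. if entry s 15 = a then entry s 22 = b else False)))"
  unfolding points_def stab5_def by (simp only: eval_simps cong: eval_congs)

lemma stab5_complete:
  assumes g: "g \<in> carrier M24" and "\<forall>x \<in> set base. g x = x"
  shows "\<exists>s \<in> set stab5. g = entry s"
proof -
  let ?O = "[24, 23, 19, 18, 17, 15, 13, 1] :: nat list"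
  have inj: "g x = g y \<longleftrightarrow> x = y" for x y using inj_M24[OF g] by (auto dest: injD)
  have O: "g ` set ?O = set ?O"
    by (rule octad_fixed_list[OF g syndrome_two_octads(1), where P = "\<lambda>x. x \<in> set
     base"])
      (use assms(2) in \<open>auto simp: base_def\<close>)
  have "g 15 \<in> set ?O" using O by auto
  moreover have "g 15 \<notin> set base"
  proof
    assume *: "g 15 \<in> set base"
    then have "g 15 = 15" using assms(2) inj by blast
    with * show False by (simp add: base_def)
  qed
  ultimately have g15: "g 15 \<in> set [15, 13, 1]" by (auto simp: base_def)
  have g22: "g 22 \<notin> set ?O"
  proof
    assume "g 22 \<in> set ?O"
    then have "g 22 \<in> g ` set ?O" unfolding O .
    then obtain x where x: "x \<in> set ?O" "g 22 = g x" by (elim imageE)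
    then have "x = 22" using inj by simp
    with x(1) show False by simp
  qed
  have "g 22 \<in> set points" using in_points_M24[OF g] by (simp add: set_points)
  then have "if g 22 \<in> set ?O then True
      else \<exists>s \<in> set stab5. if entry s 15 = g 15 then entry s 22 = g 22 else False"
    by (rule bspec[OF bspec[OF stab5_regular[unfolded all_in_iff some_in_iff mem_iff] g15]])
  with g22 obtain s where s: "s \<in> set stab5" "entry s 15 = g 15" "entry s 22 = g 22"
    unfolding if_not_P[OF g22] by (metis (full_types))
  have sM: "entry s \<in> carrier M24" using s(1) by (rule stab5_in_M24)
  have inv: "inv' (entry s) (entry s x) = x" for x
    using inj_M24[OF sM] by simp
  have "inv' (entry s) \<circ> g = id"
  proof (rule seven_fixed_points)
    show "inv' (entry s) \<circ> g \<in> carrier M24"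
      using sM g by (intro comp_in_carrier_M24 inv_in_carrier_M24)
    have "inv' (entry s) x = x" if "x \<in> set base" for x
      using stab5_fixes s(1) that inv[of x] by (simp add: all_in_iff)
    then show "\<forall>x \<in> set ([15, 22] @ base). (inv' (entry s) \<circ> g) x = x"
      using assms(2) s(2,3) inv[of 15] inv[of 22] by auto
  qed
  then have "entry s \<circ> inv' (entry s) \<circ> g = entry s" by (metis comp_assoc comp_id)
  moreover have "entry s \<circ> inv' (entry s) = id"
    using sM unfolding carrier_M24 by (blast intro: permutes_inv_o)
  ultimately show ?thesis using s(1) by auto
qed

section \<open>Computing cycle shapes\<close>

lemma orbit_funpow:
  fixes g :: "'a \<Rightarrow> 'a" and x
  assumes "permutation g"
  defines "m \<equiv> card (Orbits.orbit g x)"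
  shows "0 < m" "(g ^^ m) x = x" "\<And>n. 0 < n \<Longrightarrow> n < m \<Longrightarrow> (g ^^ n) x \<noteq> x"
    "Orbits.orbit g x = (\<lambda>n. (g ^^ n) x) ` {0..<m}" "inj_on (\<lambda>n. (g ^^ n) x) {0..<m}"
proof -
  have self: "x \<in> Orbits.orbit g x" using assms(1) by (rule permutation_self_in_orbit)
  have m: "m = funpow_dist1 g x x"
    unfolding m_def orbit_conv_funpow_dist1[OF self]
    using inj_on_funpow_dist1[OF self] by (simp add: card_image)
  show "0 < m" using m by simp
  show "(g ^^ m) x = x" unfolding m using self by (rule funpow_dist1_prop)
  show "(g ^^ n) x \<noteq> x" if "0 < n" "n < m" for n
    using that funpow_dist1_least unfolding m by metis
  show "Orbits.orbit g x = (\<lambda>n. (g ^^ n) x) ` {0..<m}"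
    unfolding m using self by (rule orbit_conv_funpow_dist1)
  show "inj_on (\<lambda>n. (g ^^ n) x) {0..<m}"
    unfolding m using self by (rule inj_on_funpow_dist1)
qed

text \<open>
  Follows the orbit of \<open>x\<close>, where \<open>y\<close> is the \<open>n\<close>-th image of \<open>x\<close>: the result is the length of the
  cycle if \<open>x\<close> is its least element, and 0 otherwise, so that every cycle is counted once. The test
  on 24 only serves termination.
\<close>

function walk :: "(nat \<Rightarrow> nat) \<Rightarrow> nat \<Rightarrow> nat \<Rightarrow> nat \<Rightarrow> nat" where
  "walk g x n y =
     (if y = x then n else if y < x then 0 else if 24 < n then 0 else walk g x (n + 1) (g y))"
  by auto
termination by (relation "measure (\<lambda>(g, x, n, y). 25 - n)") auto

declare walk.simps [simp del]

text \<open>The invariant is that all earlier images of \<open>x\<close> exceed \<open>x\<close>. A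
  cycle has at most 24 points, so it closes before the test on 24 can end the walk.\<close>

lemma walk_eq:
  assumes g: "g permutes {1..24}" and x: "x \<in> {1..24}"
  shows "walk g x 1 (g x) =
    (if \<forall>y \<in> Orbits.orbit g x. x \<le> y then card (Orbits.orbit g x) else 0)"
proof -
  have perm: "permutation g" using g by (rule permutes_imp_permutation[OF finite_atLeastAtMost])
  define m where "m = card (Orbits.orbit g x)"
  note orb = orbit_funpow[where x = x, OF perm, folded m_def]
  have "Orbits.orbit g x \<subseteq> {1..24}" using g x by (rule permutes_orbit_subset)
  then have "m \<le> 24" unfolding m_def using card_mono[of "{1..24::nat}"] by simp
  have "walk g x n ((g ^^ n) x) = (if \<forall>y \<in> Orbits.orbit g x. x \<le> y then m else 0)"
    if "0 < n" "n \<le> m" "\<forall>i. 0 < i \<longrightarrow> i < n \<longrightarrow> x < (g ^^ i) x" for n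
    using that
  proof (induction "m - n" arbitrary: n rule: less_induct)
    case less
    consider "(g ^^ n) x = x" | "(g ^^ n) x < x" | "x < (g ^^ n) x" by linarith
    then show ?case
    proof cases
      case 1
      then have "n = m" using orb(3) less.prems by (metis le_neq_implies_less)
      moreover have "x \<le> (g ^^ i) x" if "i < m" for i
        using that less.prems(3) \<open>n = m\<close> by (cases "i = 0") (auto intro: less_imp_le)
      then have "\<forall>y \<in> Orbits.orbit g x. x \<le> y" unfolding orb(4) by auto
      ultimately show ?thesis using 1 by (simp add: walk.simps)
    next
      case 2
      have "(g ^^ n) x \<in> Orbits.orbit g x"
        using less.prems(1) by (auto simp: orbit_altdef)
      with 2 show ?thesis by (subst walk.simps) (auto simp: not_le)
    next
      case 3
      then have "n < m" using orb(2) less.prems(2) by (metis le_neq_implies_less less_irrefl)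
      have "\<forall>i. 0 < i \<longrightarrow> i < n + 1 \<longrightarrow> x < (g ^^ i) x"
        using 3 less.prems(3) by (metis less_Suc_eq Suc_eq_plus1)
      with \<open>n < m\<close> have "walk g x (n + 1) ((g ^^ (n + 1)) x) =
          (if \<forall>y \<in> Orbits.orbit g x. x \<le> y then m else 0)"
        using less.hyps[of "n + 1"] by simp
      moreover have "(g ^^ (n + 1)) x = g ((g ^^ n) x)" by (simp flip: Suc_eq_plus1)
      ultimately show ?thesis
        using 3 \<open>n < m\<close> \<open>m \<le> 24\<close> by (subst walk.simps) simp
    qed
  qed
  from this[of 1] orb(1) show ?thesis by (simp add: m_def One_nat_def)
qed

text \<open>The value 0 of \<open>walk\<close> marks a cycle that is counted at its least element
  instead. Keeping the lengths sorted allows a comparison with literal lists.\<close>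

definition insort_pos :: "nat \<Rightarrow> nat list \<Rightarrow> nat list" where
  "insort_pos n L = (if n = 0 then L else insort n L)"

fun cycle_lengths :: "(nat \<Rightarrow> nat) \<Rightarrow> nat list \<Rightarrow> nat list" where
  "cycle_lengths g [] = []"
| "cycle_lengths g (x # xs) = insort_pos (walk g x 1 (g x)) (cycle_lengths g xs)"

text \<open>The points that are least in their orbits form a system of representatives: the orbit
  map is injective on \<open>R\<close> and reaches every orbit.\<close>

lemma mset_cycle_lengths:
  assumes g: "g permutes {1..24}"
  shows "mset (cycle_lengths g points) = cycle_shape g"
proof -
  let ?orb = "Orbits.orbit g"
  define P where "P x \<longleftrightarrow> (\<forall>y \<in> ?orb x. x \<le> y)" for x
  define R where "R = {x \<in> {1..24}. P x}"
  have perm: "permutation g" using g by (rule permutes_imp_permutation[OF finite_atLeastAtMost])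
  have card: "0 < card (?orb x)" for x using orbit_funpow(1)[OF perm] .
  have "mset (cycle_lengths g xs) = image_mset (\<lambda>x. card (?orb x)) (mset (filter P xs))"
    if "set xs \<subseteq> {1..24}" for xs
    using that
  proof (induction xs)
    case (Cons x xs)
    have "walk g x 1 (g x) = (if P x then card (?orb x) else 0)"
      unfolding P_def using Cons.prems by (intro walk_eq[OF g]) auto
    with Cons card[of x] show ?case by (auto simp: insort_pos_def)
  qed simp
  from this[of points] have "mset (cycle_lengths g points) =
      image_mset (\<lambda>x. card (?orb x)) (mset (filter P points))"
    by (simp add: set_points)
  also have "distinct points" by (simp add: points_def)
  then have "mset (filter P points) = mset_set R"
    unfolding R_def set_points[symmetric] by (metis distinct_filter mset_set_set set_filter)
  also have "image_mset (\<lambda>x. card (?orb x)) (mset_set R) =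
      image_mset card (image_mset ?orb (mset_set R))"
    by (simp add: image_mset.compositionality comp_def)
  also have "image_mset ?orb (mset_set R) = mset_set (?orb ` R)"
  proof (rule image_mset_mset_set, rule inj_onI)
    fix x y assume "x \<in> R" "y \<in> R" "?orb x = ?orb y"
    then show "x = y"
      using permutation_self_in_orbit[OF perm] unfolding R_def P_def
      by (metis (no_types, lifting) antisym mem_Collect_eq)
  qed
  also have "?orb ` R = ?orb ` {1..24}"
  proof (intro equalityI subsetI)
    fix B assume "B \<in> ?orb ` {1..24}"
    then obtain x where x: "x \<in> {1..24}" "B = ?orb x" by blast
    have fin: "finite (?orb x)" "?orb x \<noteq> {}"
      using card[of x] by (auto simp: card_gt_0_iff)
    define y where "y = Min (?orb x)"
    have y: "y \<in> ?orb x" unfolding y_def using fin by (rule Min_in)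
    have eq: "?orb y = ?orb x"
      using y by (metis orbit_eqI(2) orbit_swap orbit_trans permutation_self_in_orbit[OF perm]
       subsetI subset_antisym)
    have "y \<in> {1..24}" using permutes_orbit_subset[OF g x(1)] y by blast
    moreover have "P y" unfolding P_def eq using fin by (simp add: y_def)
    ultimately have "y \<in> R" unfolding R_def by blast
    with eq x(2) show "B \<in> ?orb ` R" by (metis imageI)
  qed (auto simp: R_def)
  finally show ?thesis unfolding cycle_shape_def .
qed

lemma orbit_conjugate:
  assumes "bij c"
  shows "Orbits.orbit (c \<circ> g \<circ> inv' c) (c x) = c ` Orbits.orbit g x"
proof -
  have "((c \<circ> g \<circ> inv' c) ^^ n) (c x) = c ((g ^^ n) x)" for n
    using assms by (induction n) (simp_all add: bij_is_inj)
  then show ?thesis by (auto simp: orbit_altdef)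
qed

lemma cycle_shape_conjugate:
  assumes "c permutes {1..24}"
  shows "cycle_shape (c \<circ> g \<circ> inv' c) = cycle_shape g"
proof -
  have c: "bij c" "inj c" using assms by (simp_all add: permutes_bij permutes_inj)
  have "Orbits.orbit (c \<circ> g \<circ> inv' c) ` {1..24} = Orbits.orbit (c \<circ> g \<circ> inv' c) ` c ` {1..24}"
    using permutes_image[OF assms] by simp
  also have "\<dots> = (`) c ` Orbits.orbit g ` {1..24}"
    by (simp only: image_image orbit_conjugate[OF c(1)])
  finally have "mset_set (Orbits.orbit (c \<circ> g \<circ> inv' c) ` {1..24}) =
      image_mset ((`) c) (mset_set (Orbits.orbit g ` {1..24}))"
    using inj_on_image[of c UNIV] c(2)
    by (simp add: image_mset_mset_set inj_on_def inj_image_eq_iff)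
  moreover have "card (c ` B) = card B" for B
    using c(2) by (simp add: card_image inj_on_subset)
  ultimately show ?thesis
    by (simp add: cycle_shape_def image_mset.compositionality comp_def)
qed

section \<open>Every element is conjugate to one of 768 tables\<close>

text \<open>
  The bound going with a table is an upper bound for the cycle lengths of the elements that have to
  be compared with it.
\<close>

definition patterns :: "(nat \<times> table) list" where
  "patterns = [
    (24, Table [13, 21, 14, 22, 3, 6, 5, 7, 12, 8, 20, 11, 15, 16, 1, 9, 24, 17, 18, 4, 10, 2, 19,
     23]),
    (24, Table [24, 8, 21, 20, 11, 16, 4, 3, 22, 14, 12, 7, 13, 10, 1, 5, 15, 17, 18, 9, 6, 2, 19,
     23]),
    (24, Table [9, 15, 13, 11, 21, 10, 14, 4, 5, 24, 8, 20, 7, 2, 6, 12, 22, 17, 18, 3, 16, 1, 19,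
     23]),
    (4, Table [15, 22, 3, 21, 14, 12, 5, 20, 6, 10, 7, 16, 13, 11, 1, 9, 17, 24, 18, 4, 8, 2, 19,
     23]),
    (4, Table [13, 3, 10, 6, 20, 8, 9, 16, 7, 22, 21, 14, 17, 12, 1, 4, 15, 24, 18, 5, 11, 2, 19,
     23]),
    (4, Table [10, 17, 13, 21, 16, 12, 4, 20, 7, 15, 6, 14, 3, 8, 2, 9, 22, 24, 18, 5, 11, 1, 19,
     23]),
    (3, Table [13, 22, 10, 9, 16, 12, 6, 20, 5, 3, 4, 14, 15, 8, 1, 21, 17, 18, 24, 7, 11, 2, 19,
     23]),
    (3, Table [17, 3, 22, 4, 14, 8, 7, 16, 9, 10, 5, 20, 13, 11, 1, 6, 15, 18, 24, 21, 12, 2, 19,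
     23]),
    (3, Table [3, 17, 15, 9, 14, 12, 7, 20, 4, 13, 5, 16, 10, 11, 2, 21, 22, 18, 24, 6, 8, 1, 19,
     23]),
    (3, Table [15, 9, 16, 22, 10, 5, 6, 4, 12, 11, 20, 8, 13, 14, 1, 21, 18, 17, 24, 7, 3, 2, 19,
     23]),
    (3, Table [13, 16, 11, 12, 4, 3, 21, 8, 20, 9, 22, 10, 18, 5, 1, 7, 15, 17, 24, 6, 14, 2, 19,
     23]),
    (3, Table [5, 15, 18, 14, 8, 6, 3, 10, 16, 13, 7, 2, 21, 12, 4, 20, 22, 17, 24, 11, 9, 1, 19,
     23]),
    (2, Table [13, 3, 22, 7, 20, 5, 12, 14, 6, 10, 21, 16, 15, 9, 1, 11, 17, 19, 18, 8, 4, 2, 24,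
     23]),
    (2, Table [17, 10, 3, 21, 16, 9, 8, 20, 7, 22, 6, 14, 13, 4, 1, 12, 15, 19, 18, 11, 5, 2, 24,
     23]),
    (2, Table [3, 13, 17, 6, 20, 4, 12, 16, 7, 15, 21, 14, 10, 9, 2, 8, 22, 19, 18, 11, 5, 1, 24,
     23]),
    (2, Table [13, 3, 22, 11, 9, 14, 21, 5, 8, 10, 12, 4, 15, 20, 1, 7, 17, 18, 19, 6, 16, 2, 23,
     24])]"

text \<open>The base is read along cycles: part of a cycle of length at least 5; a 4-cycle and a
  point; a 3-cycle and two points, the first of them fixed or sent to the second; two transpositions
  and a point; five fixed points. Except in the last case, the image of 17 is a base point, 15 or
  22, the latter two being the kinds of a sixth point.\<close>

definition pattern_images :: "(nat \<times> nat list) list" where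
  "pattern_images = [
    (24, [23, 19, 18, 17, 24]), (24, [23, 19, 18, 17, 15]), (24, [23, 19, 18, 17, 22]),
    (4, [23, 19, 18, 24, 17]), (4, [23, 19, 18, 24, 15]), (4, [23, 19, 18, 24, 22]),
    (3, [23, 19, 24, 18, 17]), (3, [23, 19, 24, 18, 15]), (3, [23, 19, 24, 18, 22]),
    (3, [23, 19, 24, 17, 18]), (3, [23, 19, 24, 17, 15]), (3, [23, 19, 24, 17, 22]),
    (2, [23, 24, 18, 19, 17]), (2, [23, 24, 18, 19, 15]), (2, [23, 24, 18, 19, 22]),
    (2, [24, 23, 19, 18, 17])]"

lemma patterns_images: "map (\<lambda>(m, h). (m, map (entry h) base)) patterns = pattern_images"
  unfolding patterns_def base_def pattern_images_def by (simp only: prod.case eval_simps cong: eval_congs)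

lemma patterns_preserve_code: "all_in patterns (\<lambda>(m, h). preserves_code h)"
  unfolding patterns_def
  by (simp only: preserves_code_def basis_def points_def prod.case syndrome_simps eval_simps
    cong: eval_congs)

lemma patterns_in_M24: "(m, h) \<in> set patterns \<Longrightarrow> entry h \<in> carrier M24"
  using patterns_preserve_code by (auto simp: all_in_iff intro: preserves_code_in_M24)

definition has_normal_form :: "nat \<Rightarrow> (nat \<Rightarrow> nat) \<Rightarrow> bool" where
  "has_normal_form m g \<longleftrightarrow> (\<exists>c \<in> carrier M24. \<exists>h s. (m, h) \<in> set patterns \<and> s \<in> set stab5 \<and>
     c \<circ> g \<circ> inv' c = entry h \<circ> entry s)"

text \<open>The conjugate of \<open>g\<close> acts on the base like some pattern \<open>h\<close>,
  hence differs from \<open>h\<close> by an element fixing the base, which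
  \<open>stab5_complete\<close> finds among the 48 tables. Only the action of \<open>h\<close> on
  the base enters, so 16 cosets of 48 elements suffice.\<close>

lemma has_normal_formI:
  assumes g: "g \<in> carrier M24" and c: "c \<in> carrier M24" "map c as = base"
    and "(m, map (c \<circ> g) as) \<in> set pattern_images"
  shows "has_normal_form m g"
proof -
  obtain h where h: "(m, h) \<in> set patterns" "map (entry h) base = map (c \<circ> g) as"
    using assms(4) unfolding patterns_images[symmetric] by auto
  define g' where "g' = c \<circ> g \<circ> inv' c"
  have g': "g' \<in> carrier M24"
    unfolding g'_def using g c by (intro comp_in_carrier_M24 inv_in_carrier_M24)
  have "map g' base = map (c \<circ> g) as"
    unfolding c(2)[symmetric] g'_def using inj_M24[OF c(1)] by simp
  then have *: "\<forall>x \<in> set base. g' x = entry h x"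
    unfolding h(2)[symmetric] by simp
  have hM: "entry h \<in> carrier M24" using h(1) by (rule patterns_in_M24)
  have "inv' (entry h) \<circ> g' \<in> carrier M24"
    using hM g' by (intro comp_in_carrier_M24 inv_in_carrier_M24)
  moreover have "\<forall>x \<in> set base. (inv' (entry h) \<circ> g') x = x"
    using * inj_M24[OF hM] by simp
  ultimately obtain s where s: "s \<in> set stab5" "inv' (entry h) \<circ> g' = entry s"
    using stab5_complete by blast
  have "entry h \<circ> inv' (entry h) = id"
    using hM unfolding carrier_M24 by (blast intro: permutes_inv_o)
  then have "g' = entry h \<circ> entry s"
    unfolding s(2)[symmetric] by (simp flip: comp_assoc)
  with h(1) s(1) c(1) show ?thesis unfolding has_normal_form_def g'_def by blast
qed

text \<open>For five points that \<open>g\<close> permutes among themselves: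
  \<open>map c as = base\<close> then determines the images
  \<open>map (c \<circ> g) as\<close>.\<close>

lemma normal_form_old:
  assumes "g \<in> carrier M24" "distinct as" "set as \<subseteq> {1..24}" "length as = 5"
    and "\<And>c. map c as = base \<Longrightarrow> (m, map (c \<circ> g) as) \<in> set pattern_images"
  shows "has_normal_form m g"
  using five_transitive[of as] assms has_normal_formI[OF assms(1)]
  by (metis base_length order_refl take_all)

text \<open>For five points with exactly one image \<open>y\<close> outside: its place is the only
  freedom left, and it is normalised to 15 or 22.\<close>

lemma normal_form_new:
  assumes "g \<in> carrier M24" "distinct (y # as)" "set (y # as) \<subseteq> {1..24}" "length as = 5"
    and "\<And>c. map c as = base \<Longrightarrow> c y = 15 \<or> c y = 22 \<Longrightarrow> (m, map (c \<circ> g) as) \<in> set pattern_images"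
  shows "has_normal_form m g"
  using normalize_six_points[OF assms(2-4)] assms(5) has_normal_formI[OF assms(1)] by metis

lemma fresh_point:
  fixes as :: "nat list"
  assumes "length as < 24"
  obtains z where "z \<in> {1..24}" "z \<notin> set as"
proof -
  have "\<not> {1..24} \<subseteq> set as"
    using assms card_length[of as] card_mono[of "set as" "{1..24}"] by fastforce
  with that show thesis by blast
qed

text \<open>The five points run along cycles so that at most one of their images is a new point. The
  cases descend with the available cycle length, which supplies the bound \<open>m\<close> in the
  cases of short cycles.\<close>

lemma normal_form_exists:
  assumes g: "g \<in> carrier M24"
  obtains m where "has_normal_form m g" "\<forall>x \<in> {1..24}. card (Orbits.orbit g x) \<le> m"
proof -
  define l where "l x = card (Orbits.orbit g x)" for x
  have gp: "g permutes {1..24}" using g by (simp add: carrier_M24)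
  have perm: "permutation g" using gp by (rule permutes_imp_permutation[OF finite_atLeastAtMost])
  note orb = orbit_funpow[OF perm, folded l_def]
  have inj: "g x = g y \<longleftrightarrow> x = y" for x y using inj_M24[OF g] by (auto dest: injD)
  have pts: "g x \<in> {1..24} \<longleftrightarrow> x \<in> {1..24}" for x using in_points_M24[OF
   g] .
  have injpow: "(g ^^ i) x \<noteq> (g ^^ j) x" if "i < j" "j < l x" for i j x
    using orb(5)[of x] that by (auto dest!: inj_onD)
  have le: "l x \<le> 24" if "x \<in> {1..24}" for x
    using card_mono[OF _ permutes_orbit_subset[OF gp that]] by (simp add: l_def)
  have pow: "(g ^^ 2) x = g (g x)" "(g ^^ 3) x = g (g (g x))" "(g ^^ 4) x = g (g (g (g x)))"
    "(g ^^ 5) x = g (g (g (g (g x))))" "(g ^^ 1) x = g x" for x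
    by (simp_all add: eval_nat_numeral One_nat_def)
  consider (long) x where "x \<in> {1..24}" "5 \<le> l x"
    | (four) x where "x \<in> {1..24}" "l x = 4" "\<forall>x \<in> {1..24}. l x \<le> 4"
    | (three) x where "x \<in> {1..24}" "l x = 3" "\<forall>x \<in> {1..24}. l x \<le> 3"
    | (two) "\<forall>x \<in> {1..24}. l x \<le> 2"
  proof -
    have step: "(\<exists>x \<in> {1..24}. l x = k + 1) \<or> (\<forall>x \<in> {1..24}. l x \<le> k)"
      if "\<forall>x \<in> {1..24}. l x \<le> k + 1" for k
      using that by (metis le_Suc_eq Suc_eq_plus1)
    show thesis
    proof (cases "\<forall>x \<in> {1..24}. l x \<le> 4")
      case False
      then obtain x where "x \<in> {1..24}" "\<not> l x \<le> 4" by blast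
      then show thesis by (intro that(1)[of x]) simp_all
    next
      case le4: True
      show thesis
      proof (cases "\<forall>x \<in> {1..24}. l x \<le> 3")
        case False
        with step[of 3] le4 obtain x where "x \<in> {1..24}" "l x = 4" by auto
        then show thesis using le4 by (rule that(2))
      next
        case le3: True
        show thesis
        proof (cases "\<forall>x \<in> {1..24}. l x \<le> 2")
          case False
          with step[of 2] le3 obtain x where "x \<in> {1..24}" "l x = 3" by auto
          then show thesis using le3 by (rule that(3))
        qed (rule that(4))
      qed
    qed
  qed
  then have "\<exists>m. has_normal_form m g \<and> (\<forall>x \<in> {1..24}. l x \<le> m)"
  proof cases
    case long
    let ?as = "[x, g x, g (g x), g (g (g x)), g (g (g (g x)))]"
    have ne: "x \<noteq> g x" "x \<noteq> g (g x)" "x \<noteq> g (g (g x))" "x \<noteq> g (g (g (g x)))"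
      using orb(3)[of 1 x] orb(3)[of 2 x] orb(3)[of 3 x] orb(3)[of 4 x] long(2) pow by auto
    have as: "distinct ?as" "set ?as \<subseteq> {1..24}"
      using ne long(1) by (simp_all add: inj pts del: atLeastAtMost_iff)
    have "has_normal_form 24 g"
    proof (cases "(g ^^ 5) x = x")
      case True
      then show ?thesis using as pow(4)[of x]
        by (intro normal_form_old[OF g as]) (auto simp: base_def pattern_images_def)
    next
      case False
      then have "distinct ((g ^^ 5) x # ?as)" "set ((g ^^ 5) x # ?as) \<subseteq> {1..24}"
        using as ne long(1) by (simp_all add: inj pts pow del: atLeastAtMost_iff)
      then show ?thesis
        by (rule normal_form_new[OF g]) (auto simp: base_def pattern_images_def pow)
    qed
    then show ?thesis using le by blast
  next
    case four
    have x: "g (g (g (g x))) = x" using orb(2)[of x] four(2) pow by simp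
    have ne: "x \<noteq> g x" "x \<noteq> g (g x)" "x \<noteq> g (g (g x))"
      using orb(3)[of 1 x] orb(3)[of 2 x] orb(3)[of 3 x] four(2) pow by auto
    obtain z where z: "z \<in> {1..24}" "z \<notin> set [x, g x, g (g x), g (g (g x))]"
      by (rule fresh_point[of "[x, g x, g (g x), g (g (g x))]"]) simp_all
    let ?as = "[x, g x, g (g x), g (g (g x)), z]"
    have as: "distinct ?as" "set ?as \<subseteq> {1..24}"
      using ne z four(1) by (simp_all add: inj pts del: atLeastAtMost_iff)
    have "g z \<notin> set [x, g x, g (g x), g (g (g x))]"
      using z(2) inj x by (metis list.set_intros set_ConsD empty_iff list.set(1))
    have "has_normal_form 4 g"
    proof (cases "g z = z")
      case True
      then show ?thesis using x
        by (intro normal_form_old[OF g as]) (auto simp: base_def pattern_images_def)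
    next
      case False
      then have "distinct (g z # ?as)" "set (g z # ?as) \<subseteq> {1..24}"
        using as z(1) \<open>g z \<notin> _\<close> by (auto simp: pts simp del: atLeastAtMost_iff)
      then show ?thesis
        by (rule normal_form_new[OF g]) (auto simp: base_def pattern_images_def x)
    qed
    then show ?thesis using four(3) by blast
  next
    case three
    have x: "g (g (g x)) = x" using orb(2)[of x] three(2) pow by simp
    have ne: "x \<noteq> g x" "x \<noteq> g (g x)"
      using orb(3)[of 1 x] orb(3)[of 2 x] three(2) pow by auto
    have out: "g z \<notin> set [x, g x, g (g x)]" if "z \<notin> set [x, g x, g (g x)]" for z
      using that inj x by (metis list.set_intros set_ConsD empty_iff list.set(1))
    obtain z where z: "z \<in> {1..24}" "z \<notin> set [x, g x, g (g x)]"
      by (rule fresh_point[of "[x, g x, g (g x)]"]) simp_all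
    have "has_normal_form 3 g"
    proof (cases "g z = z")
      case fixed: True
      obtain w where w: "w \<in> {1..24}" "w \<notin> set [x, g x, g (g x), z]"
        by (rule fresh_point[of "[x, g x, g (g x), z]"]) simp_all
      let ?as = "[x, g x, g (g x), z, w]"
      have as: "distinct ?as" "set ?as \<subseteq> {1..24}"
        using ne z w three(1) by (simp_all add: inj pts del: atLeastAtMost_iff)
      have "g w \<noteq> z" using w(2) inj fixed by (metis list.set_intros)
      show ?thesis
      proof (cases "g w = w")
        case True
        then show ?thesis using x fixed
          by (intro normal_form_old[OF g as]) (auto simp: base_def pattern_images_def)
      next
        case False
        then have "distinct (g w # ?as)" "set (g w # ?as) \<subseteq> {1..24}"
          using as w \<open>g w \<noteq> z\<close> out[of w] by (auto simp: pts simp del: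
           atLeastAtMost_iff)
        then show ?thesis
          by (rule normal_form_new[OF g]) (auto simp: base_def pattern_images_def x fixed)
      qed
    next
      case moved: False
      let ?as = "[x, g x, g (g x), z, g z]"
      have as: "distinct ?as" "set ?as \<subseteq> {1..24}"
        using ne z three(1) moved out[OF z(2)] by (auto simp: inj pts simp del: atLeastAtMost_iff)
      show ?thesis
      proof (cases "g (g z) = z")
        case True
        then show ?thesis using x
          by (intro normal_form_old[OF g as]) (auto simp: base_def pattern_images_def)
      next
        case False
        then have "distinct (g (g z) # ?as)" "set (g (g z) # ?as) \<subseteq> {1..24}"
          using as moved out[OF out[OF z(2)]] by (auto simp: inj pts simp del: atLeastAtMost_iff)
        then show ?thesis
          by (rule normal_form_new[OF g]) (auto simp: base_def pattern_images_def x)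
      qed
    qed
    then show ?thesis using three(3) by blast
  next
    case two
    have sq: "g (g x) = x" for x
    proof (cases "x \<in> {1..24}")
      case True
      then have "l x = 1 \<or> l x = 2" using two orb(1)[of x] by force
      then show ?thesis using orb(2)[of x] pow(1,5)[of x] by auto
    next
      case False
      then show ?thesis using permutes_not_in[OF gp] by simp
    qed
    have "has_normal_form 2 g"
    proof (cases "\<exists>x \<in> {1..24}. \<exists>z \<in> {1..24}. g x \<noteq> x \<and> g z \<noteq> z \<and> z \<noteq> x \<and> z \<noteq> g x")
      case True
      then obtain x z where xz: "x \<in> {1..24}" "z \<in> {1..24}" "g x \<noteq> x" "g z \<noteq> z" "z \<noteq> x" "z \<noteq> g x"
        by blast
      obtain w where w: "w \<in> {1..24}" "w \<notin> set [x, g x, z, g z]"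
        by (rule fresh_point[of "[x, g x, z, g z]"]) simp_all
      let ?as = "[x, g x, z, g z, w]"
      have as: "distinct ?as" "set ?as \<subseteq> {1..24}"
        using xz w sq by (simp_all add: inj pts del: atLeastAtMost_iff) metis
      have "g w \<notin> set [x, g x, z, g z]"
        using w(2) inj sq by (metis list.set_intros set_ConsD empty_iff list.set(1))
      show ?thesis
      proof (cases "g w = w")
        case True
        then show ?thesis using sq
          by (intro normal_form_old[OF g as]) (auto simp: base_def pattern_images_def)
      next
        case False
        then have "distinct (g w # ?as)" "set (g w # ?as) \<subseteq> {1..24}"
          using as w(1) \<open>g w \<notin> _\<close> by (auto simp: pts simp del: atLeastAtMost_iff)
        then show ?thesis
          by (rule normal_form_new[OF g]) (auto simp: base_def pattern_images_def sq)
      qed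
    next
      case False
      \<comment> \<open>At most one transposition remains, and every point outside it is fixed. For
        the identity any \<open>x\<close> serves.\<close>
      obtain x where fixed: "g z = z" if "z \<in> {1..24}" "z \<notin> set [x, g x]" for z
      proof (cases "\<exists>x \<in> {1..24}. g x \<noteq> x")
        case True
        with False that show thesis by (metis list.set_intros)
      qed (use that in blast)
      obtain a where a: "a \<in> {1..24}" "a \<notin> set [x, g x]"
        by (rule fresh_point[of "[x, g x]"]) simp_all
      obtain b where b: "b \<in> {1..24}" "b \<notin> set [x, g x, a]"
        by (rule fresh_point[of "[x, g x, a]"]) simp_all
      obtain c where c: "c \<in> {1..24}" "c \<notin> set [x, g x, a, b]"
        by (rule fresh_point[of "[x, g x, a, b]"]) simp_all
      obtain d where d: "d \<in> {1..24}" "d \<notin> set [x, g x, a, b, c]"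
        by (rule fresh_point[of "[x, g x, a, b, c]"]) simp_all
      obtain e where e: "e \<in> {1..24}" "e \<notin> set [x, g x, a, b, c, d]"
        by (rule fresh_point[of "[x, g x, a, b, c, d]"]) simp_all
      have "g a = a" "g b = b" "g c = c" "g d = d" "g e = e"
        using a b c d e fixed by auto
      moreover have "distinct [a, b, c, d, e]" "set [a, b, c, d, e] \<subseteq> {1..24}"
        using a b c d e by auto
      ultimately show ?thesis
        by (intro normal_form_old[OF g, of "[a, b, c, d, e]"])
          (auto simp: base_def pattern_images_def)
    qed
    then show ?thesis using two by blast
  qed
  with that show thesis unfolding l_def by blast
qed

section \<open>Cycle shapes of the elements\<close>

fun shape_list :: "atlas_name \<Rightarrow> nat list" where
  "shape_list C1A = [1, 1, 1, 1, 1, 1, 1, 1, 1, 1, 1, 1, 1, 1, 1, 1, 1, 1, 1, 1, 1, 1, 1, 1]"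
| "shape_list C2A = [1, 1, 1, 1, 1, 1, 1, 1, 2, 2, 2, 2, 2, 2, 2, 2]"
| "shape_list C2B = [2, 2, 2, 2, 2, 2, 2, 2, 2, 2, 2, 2]"
| "shape_list C3A = [1, 1, 1, 1, 1, 1, 3, 3, 3, 3, 3, 3]"
| "shape_list C3B = [3, 3, 3, 3, 3, 3, 3, 3]"
| "shape_list C4A = [2, 2, 2, 2, 4, 4, 4, 4]"
| "shape_list C4B = [1, 1, 1, 1, 2, 2, 4, 4, 4, 4]"
| "shape_list C4C = [4, 4, 4, 4, 4, 4]"
| "shape_list C5A = [1, 1, 1, 1, 5, 5, 5, 5]"
| "shape_list C6A = [1, 1, 2, 2, 3, 3, 6, 6]"
| "shape_list C6B = [6, 6, 6, 6]"
| "shape_list C7AB = [1, 1, 1, 7, 7, 7]"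
| "shape_list C8A = [1, 1, 2, 4, 8, 8]"
| "shape_list C10A = [2, 2, 10, 10]"
| "shape_list C11A = [1, 1, 11, 11]"
| "shape_list C12A = [2, 4, 6, 12]"
| "shape_list C12B = [12, 12]"
| "shape_list C14AB = [1, 2, 7, 14]"
| "shape_list C15AB = [1, 3, 5, 15]"
| "shape_list C21AB = [3, 21]"
| "shape_list C23AB = [1, 23]"

lemma mset_shape_list: "mset (shape_list N) = atlas_shape N"
  by (cases N) (simp_all add: numeral_eq_Suc)

definition atlas_names :: "atlas_name list" where
  "atlas_names = [C1A, C2A, C2B, C3A, C3B, C4A, C4B, C4C, C5A, C6A, C6B, C7AB, C8A,
    C10A, C11A, C12A, C12B, C14AB, C15AB, C21AB, C23AB]"

definition rho :: table where
  "rho = Table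
    [22, 16, 18, 20, 4, 12, 2, 24, 15, 8, 21, 23, 3, 1, 19, 5, 14, 10, 13, 11, 17, 7, 9, 6]"

definition tau :: table where
  "tau = Table
    [6, 3, 20, 15, 8, 1, 14, 13, 10, 16, 2, 4, 9, 21, 7, 24, 22, 17, 18, 11, 12, 5, 19, 23]"

text \<open>
  For six of the names, every element with the corresponding cycle shape is conjugate to the
  following element, which is a power of \<open>rho\<close>, of type 12B, or of \<open>tau\<close>, of type 12A.
\<close>

fun representative :: "atlas_name \<Rightarrow> nat \<Rightarrow> nat" where
  "representative C2B = entry rho ^^ 6"
| "representative C3B = entry rho ^^ 4"
| "representative C4C = entry rho ^^ 3"
| "representative C6B = entry rho ^^ 2"
| "representative C4A = entry tau ^^ 3"
| "representative C12A = entry tau"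
| "representative N = id"

text \<open>
  Each conjugator was found by a search; it carries a representative of one orbit of the normal
  forms under conjugation with the stabilizer of the base to the representative of the class.
\<close>

fun conjugators :: "atlas_name \<Rightarrow> table list" where
  "conjugators C2B = [
      Table [1, 4, 2, 3, 22, 24, 5, 14, 17, 13, 19, 11, 21, 12, 6, 20, 9, 18, 23, 16, 7, 10, 8, 15],
      Table [1, 2, 21, 3, 19, 12, 24, 22, 23, 10, 14, 11, 4, 5, 6, 20, 13, 8, 15, 18, 7, 9, 16, 17],
      Table [1, 2, 3, 21, 14, 12, 23, 22, 24, 20, 19, 18, 4, 7, 17, 10, 16, 8, 15, 11, 5, 9, 13, 6],
      Table [1, 2, 3, 12, 23, 21, 14, 10, 5, 20, 7, 11, 4, 19, 17, 22, 16, 6, 13, 18, 24, 9, 15,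
       8]]"
| "conjugators C3B = [
      Table [1, 11, 14, 16, 3, 22, 15, 19, 12, 24, 5, 6, 9, 21, 2, 10, 7, 17, 13, 18, 20, 4, 23, 8],
      Table [1, 14, 11, 17, 16, 10, 13, 8, 21, 7, 22, 5, 2, 23, 4, 19, 24, 3, 18, 12, 20, 9, 15, 6],
      Table [1, 14, 24, 3, 20, 5, 18, 21, 19, 11, 6, 22, 9, 12, 2, 15, 7, 17, 8, 10, 16, 4, 13,
       23]]"
| "conjugators C4C = [
      Table [1, 2, 3, 4, 5, 6, 7, 8, 9, 10, 11, 12, 13, 14, 15, 16, 17, 18, 19, 20, 21, 22, 23, 24],
      Table [1, 2, 3, 9, 4, 21, 6, 20, 24, 22, 16, 23, 17, 8, 15, 12, 13, 7, 14, 19, 18, 10, 11, 5],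
      Table [1, 10, 3, 6, 9, 8, 20, 16, 11, 2, 12, 5, 15, 21, 13, 4, 17, 24, 18, 14, 7, 22, 19, 23],
      Table [1, 10, 3, 16, 12, 4, 21, 6, 5, 2, 9, 11, 15, 20, 13, 8, 17, 19, 23, 7, 14, 22, 24, 18],
      Table [1, 8, 18, 11, 12, 17, 20, 23, 14, 16, 24, 3, 2, 5, 21, 15, 4, 13, 9, 19, 22, 7, 6, 10],
      Table [1, 3, 14, 24, 23, 20, 11, 5, 8, 22, 17, 18, 2, 15, 21, 12, 4, 6, 10, 16, 7, 19, 13, 9],
      Table [1, 3, 19, 8, 24, 7, 20, 18, 23, 14, 5, 17, 21, 12, 4, 16, 2, 6, 10, 15, 11, 22, 13, 9],
      Table [1, 12, 24, 11, 14, 15, 3, 17, 8, 5, 19, 7, 21, 22, 4, 23, 2, 13, 9, 18, 16, 20, 6,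
       10]]"
| "conjugators C6B = [
      Table [1, 15, 17, 11, 24, 7, 18, 3, 19, 12, 8, 6, 9, 4, 13, 10, 20, 5, 2, 16, 23, 21, 22,
       14]]"
| "conjugators C4A = [
      Table [7, 1, 12, 2, 9, 11, 24, 20, 10, 15, 18, 17, 6, 5, 21, 3, 4, 22, 19, 23, 8, 14, 16, 13],
      Table [2, 5, 9, 10, 12, 23, 14, 17, 4, 24, 1, 21, 11, 15, 3, 8, 20, 13, 22, 7, 6, 18, 19, 16],
      Table [2, 9, 24, 4, 8, 6, 17, 21, 14, 5, 23, 15, 3, 10, 20, 7, 11, 19, 16, 1, 12, 18, 13,
       22]]"
| "conjugators C12A = [
      Table [1, 2, 3, 4, 5, 6, 7, 8, 9, 10, 11, 12, 13, 14, 15, 16, 17, 18, 19, 20, 21, 22, 23, 24],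
      Table [6, 5, 8, 19, 17, 2, 24, 11, 3, 10, 23, 22, 1, 9, 4, 16, 12, 21, 14, 13, 20, 18, 7,
       15]]"
| "conjugators N = []"

lemma conjugators_preserve_code: "all_in atlas_names (\<lambda>N. all_in (conjugators N) preserves_code)"
  unfolding atlas_names_def
  by (simp only: conjugators.simps preserves_code_def basis_def points_def prod.case syndrome_simps
    eval_simps cong: eval_congs)

lemma set_atlas_names: "N \<in> set atlas_names"
  by (cases N) (simp_all add: atlas_names_def)

lemma conjugators_in_M24: "w \<in> set (conjugators N) \<Longrightarrow> entry w \<in> carrier M24"
  using conjugators_preserve_code set_atlas_names[of N]
  by (auto simp: all_in_iff intro: preserves_code_in_M24)

lemma rho_preserves_code: "preserves_code rho" "preserves_code tau"
  by (simp_all only: rho_def tau_def preserves_code_def basis_def points_def prod.case syndrome_simps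
    eval_simps cong: eval_congs)

text \<open>The stored tables treat one normal form per orbit under the stabilizer; \<open>s\<close>
  supplies the rest of the orbit. The intertwining relation is tested pointwise, so that no inverse
  has to be evaluated. An empty list of conjugators demands nothing.\<close>

definition conjugate_to_representative :: "atlas_name \<Rightarrow> (nat \<Rightarrow> nat) \<Rightarrow> bool" where
  "conjugate_to_representative N g \<longleftrightarrow> (if conjugators N = [] then True else
     some_in (conjugators N) (\<lambda>w. some_in stab5 (\<lambda>s. all_in points (\<lambda>x.
       entry w (entry s (g x)) = representative N (entry w (entry s x))))))"

text \<open>A coset also contains elements with cycles longer than the case behind its pattern
  permits. These never arise from that case and are passed over, which saves conjugators for
  them.\<close>

definition check_lengths :: "nat \<Rightarrow> (nat \<Rightarrow> nat) \<Rightarrow> nat list \<Rightarrow> bool" where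
  "check_lengths m g L \<longleftrightarrow> (if all_in L (\<lambda>l. l \<le> m)
     then some_in atlas_names (\<lambda>N. if L = shape_list N then conjugate_to_representative N g else False)
     else True)"

lemma representative_apply:
  "representative C2B x = entry rho (entry rho (entry rho (entry rho (entry rho (entry rho x)))))"
  "representative C3B x = entry rho (entry rho (entry rho (entry rho x)))"
  "representative C4C x = entry rho (entry rho (entry rho x))"
  "representative C6B x = entry rho (entry rho x)"
  "representative C4A x = entry tau (entry tau (entry tau x))"
  "representative C12A x = entry tau x"
  by (simp_all add: eval_nat_numeral One_nat_def)

lemma check_normal_forms:
  "all_in patterns (\<lambda>p. all_in stab5 (\<lambda>s. check_lengths (fst p) (entry (snd p) \<circ> entry s)
     (cycle_lengths (entry (snd p) \<circ> entry s) points)))"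
  unfolding patterns_def
  by (simp only: stab5_def points_def prod.sel check_lengths_def conjugate_to_representative_def
    cycle_lengths.simps walk.simps insort_pos_def linorder_class.insort_key.simps atlas_names_def
    shape_list.simps conjugators.simps representative_apply rho_def tau_def list.inject list.distinct
    zero_neq_numeral numeral_neq_zero zero_neq_one one_neq_zero eval_simps cong: eval_congs)

lemma conjugate_to_representativeD:
  assumes "conjugate_to_representative N g" "conjugators N \<noteq> []" "g \<in> carrier M24"
  obtains c where "c \<in> carrier M24" "c \<circ> g = representative N \<circ> c"
proof -
  obtain w s where ws: "w \<in> set (conjugators N)" "s \<in> set stab5" and
    *: "\<forall>x \<in> {1..24}. entry w (entry s (g x)) = representative N (entry w (entry s x))"
    using assms(1,2)
    by (auto simp: conjugate_to_representative_def some_in_iff all_in_iff set_points)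
  have "entry w \<circ> entry s \<in> carrier M24"
    using ws by (intro comp_in_carrier_M24 conjugators_in_M24 stab5_in_M24)
  moreover have "(entry w \<circ> entry s) \<circ> g = representative N \<circ> (entry w \<circ> entry s)"
  proof
    fix x
    show "((entry w \<circ> entry s) \<circ> g) x = (representative N \<circ> (entry w \<circ> entry s)) x"
    proof (cases "x \<in> {1..24}")
      case False
      have out: "p x = x" if "p \<in> carrier M24" for p
        using that False unfolding carrier_M24 by (meson permutes_not_in)
      have "entry rho \<in> carrier M24" "entry tau \<in> carrier M24"
        by (intro preserves_code_in_M24 rho_preserves_code)+
      then have "representative N \<in> carrier M24"
        using M24.one_closed by (cases N) (simp_all add: funpow_in_carrier_M24 del: funpow.simps)
      then show ?thesis
        using out[OF conjugators_in_M24[OF ws(1)]] out[OF stab5_in_M24[OF ws(2)]] out[OF assms(3)]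
          out[of "representative N"] by simp
    qed (use * in simp)
  qed
  ultimately show thesis using that by blast
qed

theorem M24_cycle_shapes:
  assumes g: "g \<in> carrier M24"
  obtains N where "cycle_shape g = atlas_shape N"
    "conjugators N \<noteq> [] \<Longrightarrow> \<exists>c \<in> carrier M24. c \<circ> g =
     representative N \<circ> c"
proof -
  obtain m where m: "has_normal_form m g" "\<forall>x \<in> {1..24}. card (Orbits.orbit g x) \<le> m"
    using normal_form_exists[OF g] .
  then obtain c h s where c: "c \<in> carrier M24" and h: "(m, h) \<in> set patterns" "s \<in> set stab5"
    and eq: "c \<circ> g \<circ> inv' c = entry h \<circ> entry s"
    unfolding has_normal_form_def by blast
  define g' where "g' = entry h \<circ> entry s"
  have g': "g' \<in> carrier M24"
    unfolding g'_def using h by (intro comp_in_carrier_M24 patterns_in_M24 stab5_in_M24)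
  have shape: "cycle_shape g' = cycle_shape g"
    unfolding g'_def eq[symmetric] using c by (intro cycle_shape_conjugate) (simp add: carrier_M24)
  define L where "L = cycle_lengths g' points"
  have L: "mset L = cycle_shape g"
    unfolding L_def using g' shape by (subst mset_cycle_lengths) (auto simp: carrier_M24)
  have "set L = set_mset (cycle_shape g)" unfolding L[symmetric] by simp
  also have "\<dots> = card ` Orbits.orbit g ` {1..24}" by (simp add: cycle_shape_def)
  finally have "\<forall>l \<in> set L. l \<le> m" using m(2) by auto
  moreover have "check_lengths m g' L"
    using check_normal_forms h unfolding L_def g'_def by (force simp: all_in_iff)
  ultimately obtain N where N: "L = shape_list N" "conjugate_to_representative N g'"
    by (auto simp: check_lengths_def all_in_iff some_in_iff split: if_splits)
  show thesis
  proof
    show "cycle_shape g = atlas_shape N" using L N(1) by (simp add: mset_shape_list)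
    assume "conjugators N \<noteq> []"
    then obtain d where d: "d \<in> carrier M24" "d \<circ> g' = representative N \<circ> d"
      using conjugate_to_representativeD[OF N(2) _ g'] by blast
    have "g' \<circ> c = c \<circ> g"
      unfolding g'_def eq[symmetric] using inv_comp_M24[OF c] by (simp add: comp_assoc)
    then have "d \<circ> c \<circ> g = representative N \<circ> (d \<circ> c)"
      using d(2) by (metis comp_assoc)
    with c d(1) show "\<exists>c \<in> carrier M24. c \<circ> g = representative N \<circ> c"
      by (blast intro: comp_in_carrier_M24)
  qed
qed

section \<open>Orders, classes and powers\<close>

lemma funpow_one [simp]: "(f :: 'a \<Rightarrow> 'a) ^^ 1 = f"
  by (simp add: One_nat_def)

lemma M24_permutes: "g \<in> carrier M24 \<Longrightarrow> g permutes {1..24}"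
  by (simp add: carrier_M24)

lemma M24_permutation: "g \<in> carrier M24 \<Longrightarrow> permutation g"
  by (rule permutes_imp_permutation[OF finite_atLeastAtMost M24_permutes])

lemma funpow_fixes_iff:
  assumes "permutation g"
  shows "(g ^^ n) x = x \<longleftrightarrow> card (Orbits.orbit g x) dvd n"
proof -
  define m where "m = card (Orbits.orbit g x)"
  note orb = orbit_funpow[where x = x, OF assms, folded m_def]
  have "(g ^^ n) x = (g ^^ (n mod m)) x"
    using funpow_mod_eq[OF orb(2)] by simp
  moreover have "n mod m < m" using orb(1) by simp
  ultimately show ?thesis
    using orb(3)[of "n mod m"] unfolding m_def[symmetric] dvd_eq_mod_eq_0
    by (cases "n mod m = 0") auto
qed

lemma set_cycle_shape: "set_mset (cycle_shape g) = (\<lambda>x. card (Orbits.orbit g x)) ` {1..24}"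
  by (auto simp: cycle_shape_def)

lemma funpow_id_iff:
  assumes "g \<in> carrier M24"
  shows "g ^^ n = id \<longleftrightarrow> (\<forall>l \<in># cycle_shape g. l dvd n)"
proof -
  have "(g ^^ n) x = x" if "x \<notin> {1..24}" for x
    using that permutes_not_in[OF M24_permutes[OF funpow_in_carrier_M24[OF assms]]] by blast
  then have "g ^^ n = id \<longleftrightarrow> (\<forall>x \<in> {1..24}. (g ^^ n) x = x)"
    by (auto simp: fun_eq_iff simp del: atLeastAtMost_iff)
  then show ?thesis
    unfolding set_cycle_shape funpow_fixes_iff[OF M24_permutation[OF assms]] by auto
qed

lemma ord_M24:
  assumes "g \<in> carrier M24"
  shows "M24.ord g = Lcm (set_mset (cycle_shape g))"
  unfolding M24.ord_unique[OF assms]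
  by (simp add: pow_M24 funpow_id_iff[OF assms] Lcm_dvd_iff)

lemma funpow_ord_M24: "g \<in> carrier M24 \<Longrightarrow> g ^^ M24.ord g = id"
  using M24.pow_ord_eq_1[of g] by (simp add: pow_M24)

lemma funpow_id_ord_dvd: "g \<in> carrier M24 \<Longrightarrow> g ^^ n = id \<longleftrightarrow> M24.ord g dvd n"
  by (simp add: ord_M24 funpow_id_iff Lcm_dvd_iff)

section \<open>Conjugacy classes and their names\<close>

definition conj_class :: "(nat \<Rightarrow> nat) \<Rightarrow> (nat \<Rightarrow> nat) set" where
  "conj_class h = {g \<circ> h \<circ> inv' g | g. g \<in> carrier M24}"

lemma conj_classes_M24: "conj_classes M24 = conj_class ` carrier M24"
proof -
  have "Group_Action.orbit M24 (\<lambda>g. \<lambda>h \<in> carrier M24. g \<otimes>\<^bsub>M24\<^esub> h \<otimes>\<^bsub>M24\<^esub> inv\<^bsub>M24\<^esub> g) h = conj_class h"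
    if "h \<in> carrier M24" for h
    using that unfolding Group_Action.orbit_def conj_class_def by (auto simp: inv_M24) (metis inv_M24)+
  then show ?thesis
    unfolding conj_classes_def orbits_def by auto
qed

lemma comp_inv_M24: "g \<in> carrier M24 \<Longrightarrow> g \<circ> inv' g = id"
  unfolding carrier_M24 by (blast intro: permutes_inv_o)

lemma conj_class_self: "h \<in> conj_class h"
  unfolding conj_class_def using M24.one_closed by (auto intro!: exI[of _ id])

text \<open>The hypothesis is the intertwining relation in the form that the evaluated conjugators
  provide.\<close>

lemma conj_class_eqI:
  assumes c: "c \<in> carrier M24" and eq: "c \<circ> g = h \<circ> c"
  shows "conj_class g = conj_class h"
proof -
  have *: "conj_class g \<subseteq> conj_class h" if "c \<in> carrier M24" "c \<circ> g = h \<circ> c" for c g h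
  proof
    fix f assume "f \<in> conj_class g"
    then obtain a where a: "a \<in> carrier M24" "f = a \<circ> g \<circ> inv' a" by (auto simp: conj_class_def)
    have "g = inv' c \<circ> h \<circ> c"
      using that inv_comp_M24[OF that(1)] by (metis comp_assoc id_comp)
    then have "f = (a \<circ> inv' c) \<circ> h \<circ> (c \<circ> inv' a)" using a(2) by (simp add: comp_assoc)
    moreover have "c \<circ> inv' a = inv' (a \<circ> inv' c)"
      using a(1) that(1) unfolding carrier_M24
      by (metis inv_inv_eq o_inv_distrib permutes_bij permutes_inv)
    moreover have "a \<circ> inv' c \<in> carrier M24"
      using a(1) that(1) by (intro comp_in_carrier_M24 inv_in_carrier_M24)
    ultimately show "f \<in> conj_class h" unfolding conj_class_def by auto
  qed
  have "inv' c \<circ> h = g \<circ> inv' c"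
    using eq inv_comp_M24[OF c] comp_inv_M24[OF c] by (metis comp_assoc comp_id id_comp)
  with *[OF c eq] *[OF inv_in_carrier_M24[OF c]] show ?thesis by blast
qed

lemma class_memE:
  assumes "X \<in> conj_classes M24" "g \<in> X"
  shows "g \<in> carrier M24" "X = conj_class g"
proof -
  obtain h where h: "h \<in> carrier M24" "X = conj_class h"
    using assms(1) by (auto simp: conj_classes_M24)
  then obtain c where c: "c \<in> carrier M24" "g = c \<circ> h \<circ> inv' c"
    using assms(2) by (auto simp: conj_class_def)
  then show "g \<in> carrier M24"
    using h by (auto intro!: comp_in_carrier_M24 inv_in_carrier_M24)
  have "c \<circ> h = g \<circ> c"
    using c inv_comp_M24[OF c(1)] by (simp add: comp_assoc)
  with h(2) c(1) show "X = conj_class g" by (metis conj_class_eqI)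
qed

lemma class_obtains:
  assumes "X \<in> conj_classes M24"
  obtains g where "g \<in> carrier M24" "g \<in> X" "X = conj_class g"
proof -
  obtain h where "h \<in> carrier M24" "X = conj_class h"
    using assms by (auto simp: conj_classes_M24)
  then show thesis by (intro that[of h]) (simp_all add: conj_class_self)
qed

lemma cycle_shape_class:
  assumes "g \<in> conj_class h"
  shows "cycle_shape g = cycle_shape h"
  using assms cycle_shape_conjugate by (auto simp: conj_class_def carrier_M24)

lemma class_order_M24:
  assumes "g \<in> carrier M24"
  shows "class_order M24 (conj_class g) = M24.ord g"
proof -
  have "M24.ord h = M24.ord g" if "h \<in> conj_class g" for h
    using that assms cycle_shape_class[OF that] class_memE(1)[OF _ that]
    by (simp add: ord_M24 conj_classes_M24)
  then have "M24.ord ` conj_class g = {M24.ord g}"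
    using conj_class_self by blast
  then show ?thesis by (simp add: class_order_def)
qed

text \<open>A sorted list is determined by its multiset, which reduces the claim to the distinctness
  of 21 literal lists.\<close>

lemma atlas_shape_inject: "atlas_shape M = atlas_shape N \<longleftrightarrow> M = N"
proof
  assume "atlas_shape M = atlas_shape N"
  then have "mset (shape_list M) = mset (shape_list N)" by (simp only: mset_shape_list)
  moreover have "sorted (shape_list N)" for N by (cases N) simp_all
  ultimately have "shape_list M = shape_list N"
    by (metis sort_key_id_if_sorted sorted_list_of_multiset_mset sorted_sort_id)
  moreover have "distinct (map shape_list atlas_names)" by (simp add: atlas_names_def)
  ultimately show "M = N"
    using set_atlas_names by (metis distinct_map inj_onD)
qed simp

lemma atlas_name_of_class:
  assumes "cycle_shape g = atlas_shape N"
  shows "atlas_name_of (conj_class g) = N"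
  unfolding atlas_name_of_def
proof (rule the_equality)
  show "\<forall>h \<in> conj_class g. cycle_shape h = atlas_shape N"
    using assms cycle_shape_class by auto
  show "M = N" if "\<forall>h \<in> conj_class g. cycle_shape h = atlas_shape M" for M
    using that assms conj_class_self[of g] by (metis atlas_shape_inject)
qed

lemma shape_of_atlas_name:
  assumes "g \<in> carrier M24"
  shows "cycle_shape g = atlas_shape (atlas_name_of (conj_class g))"
  using M24_cycle_shapes[OF assms] atlas_name_of_class by metis

lemma conj_class_representative:
  assumes "g \<in> carrier M24" "cycle_shape g = atlas_shape N" "conjugators N \<noteq> []"
  shows "conj_class g = conj_class (representative N)"
  using M24_cycle_shapes[OF assms(1)] assms conj_class_eqI by (metis atlas_shape_inject)

lemma shape_rho: "cycle_shape (entry rho) = atlas_shape C12B"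
  and shape_tau: "cycle_shape (entry tau) = atlas_shape C12A"
  and shape_tau_cube: "cycle_shape (entry tau ^^ 3) = atlas_shape C4A"
proof -
  have "cycle_lengths (entry rho) points = shape_list C12B"
    "cycle_lengths (entry tau) points = shape_list C12A"
    "cycle_lengths (entry tau \<circ> entry tau \<circ> entry tau) points = shape_list C4A"
    by (simp_all only: points_def cycle_lengths.simps walk.simps insort_pos_def
      linorder_class.insort_key.simps shape_list.simps rho_def tau_def list.inject
      zero_neq_numeral numeral_neq_zero zero_neq_one one_neq_zero eval_simps cong: eval_congs)
  moreover have "entry tau ^^ 3 = entry tau \<circ> entry tau \<circ> entry tau"
    by (simp add: numeral_3_eq_3 comp_assoc)
  moreover have "entry rho \<in> carrier M24" "entry tau \<in> carrier M24"
    by (intro preserves_code_in_M24 rho_preserves_code)+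
  ultimately show "cycle_shape (entry rho) = atlas_shape C12B"
    "cycle_shape (entry tau) = atlas_shape C12A" "cycle_shape (entry tau ^^ 3) = atlas_shape C4A"
    by (metis M24_permutes comp_in_carrier_M24 mset_cycle_lengths mset_shape_list)+
qed

lemma rho_tau_in_M24: "entry rho \<in> carrier M24" "entry tau \<in> carrier M24"
  by (intro preserves_code_in_M24 rho_preserves_code)+

lemma point_of_length:
  assumes "cycle_shape g = atlas_shape N" "l \<in># atlas_shape N"
  obtains x where "x \<in> {1..24}" "card (Orbits.orbit g x) = l"
  using assms set_cycle_shape[of g] by auto

section \<open>Powers of elements of shape 12B\<close>

definition power_of_12B :: "(nat \<Rightarrow> nat) \<Rightarrow> bool" where
  "power_of_12B h \<longleftrightarrow>
     (\<exists>z \<in> carrier M24. cycle_shape z = atlas_shape C12B \<and> (\<exists>d \<ge> 1. h = z ^^ d))"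

lemma conjugate_funpow:
  assumes "bij c"
  shows "(c \<circ> z \<circ> inv' c) ^^ n = c \<circ> z ^^ n \<circ> inv' c"
  using assms by (induction n) (auto simp: fun_eq_iff bij_is_inj bij_is_surj surj_f_inv_f)

lemma power_of_12B_class:
  assumes "power_of_12B h" "g \<in> conj_class h"
  shows "power_of_12B g"
proof -
  obtain z d where z: "z \<in> carrier M24" "cycle_shape z = atlas_shape C12B" "d \<ge> 1" "h = z ^^ d"
    using assms(1) by (auto simp: power_of_12B_def)
  obtain c where c: "c \<in> carrier M24" "g = c \<circ> h \<circ> inv' c"
    using assms(2) by (auto simp: conj_class_def)
  have "g = (c \<circ> z \<circ> inv' c) ^^ d"
    unfolding c(2) z(4) by (rule conjugate_funpow[OF permutes_bij[OF M24_permutes[OF c(1)]],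
     symmetric])
  moreover have "cycle_shape (c \<circ> z \<circ> inv' c) = atlas_shape C12B"
    using z(2) c(1) by (simp add: cycle_shape_conjugate carrier_M24)
  moreover have "c \<circ> z \<circ> inv' c \<in> carrier M24"
    using z(1) c(1) by (intro comp_in_carrier_M24 inv_in_carrier_M24)
  ultimately show ?thesis using z(3) unfolding power_of_12B_def by blast
qed

text \<open>All cycles of a 12B element have length 12, so its powers act semiregularly.\<close>

lemma power_of_12B_semiregular:
  assumes "power_of_12B h" "(h ^^ j) x = x" "x \<in> {1..24}"
  shows "h ^^ j = id"
proof -
  obtain z d where z: "z \<in> carrier M24" "cycle_shape z = atlas_shape C12B" "h = z ^^ d"
    using assms(1) by (auto simp: power_of_12B_def)
  have "h ^^ j = z ^^ (d * j)" by (simp add: z(3) funpow_mult mult.commute)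
  moreover have "card (Orbits.orbit z x) \<in># atlas_shape C12B"
    using assms(3) unfolding z(2)[symmetric] set_cycle_shape by blast
  then have "card (Orbits.orbit z x) = 12" by simp
  ultimately have "12 dvd d * j"
    using assms(2) funpow_fixes_iff[OF M24_permutation[OF z(1)]] by metis
  then have "z ^^ (d * j) = id"
    unfolding funpow_id_iff[OF z(1)] z(2) by simp
  with \<open>h ^^ j = z ^^ (d * j)\<close> show ?thesis by simp
qed

lemma power_of_12B_funpow:
  assumes "power_of_12B h" "d \<ge> 1"
  shows "power_of_12B (h ^^ d)"
proof -
  obtain z e where z: "z \<in> carrier M24" "cycle_shape z = atlas_shape C12B" "e \<ge> 1" "h = z ^^ e"
    using assms(1) by (auto simp: power_of_12B_def)
  have "h ^^ d = z ^^ (e * d)" by (simp add: z(4) funpow_mult mult.commute)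
  moreover have "1 \<le> e * d" using mult_le_mono[OF z(3) assms(2)] by simp
  ultimately show ?thesis using z(1,2) unfolding power_of_12B_def by blast
qed

text \<open>For 2B, 3B, 4C and 6B the shape determines the class, which is that of a power of
  \<open>rho\<close>; an element of shape 12B is its own first power.\<close>

lemma power_of_12B_by_shape:
  assumes "g \<in> carrier M24" "cycle_shape g = atlas_shape N" "N \<in> {C2B, C3B, C4C, C6B, C12B}"
  shows "power_of_12B g"
proof (cases "N = C12B")
  case True
  then show ?thesis
    unfolding power_of_12B_def using assms(1,2) by (intro bexI[of _ g] conjI exI[of _ 1]) auto
next
  case False
  have *: "power_of_12B (entry rho ^^ d)" if "d \<ge> 1" for d
    unfolding power_of_12B_def using that rho_tau_in_M24(1) shape_rho by blast
  have "conj_class g = conj_class (representative N)"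
    using assms False by (intro conj_class_representative) auto
  moreover have "power_of_12B (representative N)"
    using assms(3) False *[of 6] *[of 4] *[of 3] *[of 2] by auto
  ultimately show ?thesis using power_of_12B_class conj_class_self by metis
qed

lemma power_of_12B_id: "power_of_12B id"
proof -
  \<comment> \<open>Exponents start at 1, so the identity is obtained as the twelfth power.\<close>
  have "entry rho ^^ 12 = id"
    by (simp add: funpow_id_iff rho_tau_in_M24 shape_rho del: funpow.simps)
  then show ?thesis
    unfolding power_of_12B_def using rho_tau_in_M24(1) shape_rho
    by (intro bexI[of _ "entry rho"] conjI exI[of _ 12]) auto
qed

text \<open>Each cycle length of \<open>g ^^ d\<close> divides \<open>p\<close>, and none is 1. This
  identifies fifth powers of elements of shape 10A and seventh powers of elements of shape
  21AB.\<close>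

lemma funpow_prime_shape:
  assumes "g \<in> carrier M24" "prime p" "\<And>l. l \<in># cycle_shape g \<Longrightarrow> l dvd p * d \<and> \<not> l dvd d"
    and "l \<in># cycle_shape (g ^^ d)"
  shows "l = p"
proof -
  have gd: "g ^^ d \<in> carrier M24" using assms(1) by (rule funpow_in_carrier_M24)
  obtain x where x: "x \<in> {1..24}" "l = card (Orbits.orbit (g ^^ d) x)"
    using assms(4) by (auto simp: set_cycle_shape)
  have "(g ^^ d) ^^ p = id"
    using assms(3) by (simp add: funpow_mult funpow_id_iff[OF assms(1)] mult.commute)
  then have "l dvd p"
    unfolding x(2) using funpow_fixes_iff[OF M24_permutation[OF gd]] by (metis id_apply)
  moreover have "card (Orbits.orbit g x) \<in># cycle_shape g"
    using x(1) unfolding set_cycle_shape by blast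
  then have "(g ^^ d) x \<noteq> x"
    using assms(3) funpow_fixes_iff[OF M24_permutation[OF assms(1)]] by blast
  then have "l \<noteq> 1"
    using funpow_fixes_iff[OF M24_permutation[OF gd], of 1 x] x(2) by auto
  ultimately show ?thesis using assms(2) by (metis prime_nat_iff)
qed

section \<open>The maximal classes of powers of 12B\<close>

text \<open>The lists are sorted, so the head is the smallest cycle length.\<close>

definition max_order :: "atlas_name \<Rightarrow> nat" where
  "max_order N = (if N \<in> {C4A, C12A} then 1 else hd (shape_list N))"

lemma ord_le_max_order:
  assumes g: "g \<in> carrier M24" "cycle_shape g = atlas_shape N"
    and d: "d \<ge> 1" "power_of_12B (g ^^ d)"
  shows "M24.ord (g ^^ d) \<le> max_order N"
proof -
  let ?h = "g ^^ d"
  have h: "?h \<in> carrier M24" using g(1) by (rule funpow_in_carrier_M24)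
  \<comment> \<open>The exponent \<open>d * l\<close> fixes the points of a cycle of length
    \<open>e\<close>, and by semiregularity one fixed point makes the power trivial.\<close>
  have *: "?h ^^ l = id" if e: "e \<in># atlas_shape N" and dvd: "e dvd d * l" for e l
  proof -
    obtain x where x: "x \<in> {1..24}" "card (Orbits.orbit g x) = e"
      using point_of_length[OF g(2) e] .
    then have "(?h ^^ l) x = x"
      using dvd funpow_fixes_iff[OF M24_permutation[OF g(1)], of "d * l" x]
      by (simp add: funpow_mult mult.commute)
    with d(2) show ?thesis using x(1) by (rule power_of_12B_semiregular)
  qed
  show ?thesis
  proof (cases "N \<in> {C4A, C12A}")
    case True
    then have N: "2 \<in># atlas_shape N" "4 \<in># atlas_shape N" by auto
    have "?h ^^ 2 = id" using * N(1) by simp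
    moreover obtain x where x: "x \<in> {1..24}" "card (Orbits.orbit g x) = 4"
      using point_of_length[OF g(2) N(2)] .
    ultimately have "(g ^^ (d * 2)) x = x"
      by (simp add: funpow_mult mult.commute)
    then have "4 dvd d * 2"
      using x(2) funpow_fixes_iff[OF M24_permutation[OF g(1)]] by metis
    then have "2 dvd d * 1" by presburger
    then have "?h ^^ 1 = id" using * N(1) by blast
    then have "M24.ord ?h dvd 1" using funpow_id_ord_dvd[OF h] by blast
    with True show ?thesis by (simp add: max_order_def)
  next
    case False
    define l where "l = hd (shape_list N)"
    have "l \<in># atlas_shape N" "0 < l"
      unfolding l_def mset_shape_list[symmetric] by (cases N; simp)+
    then have "?h ^^ l = id" using * by simp
    then have "M24.ord ?h dvd l" using funpow_id_ord_dvd[OF h] by blast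
    with False \<open>0 < l\<close> show ?thesis by (simp add: max_order_def l_def dvd_imp_le)
  qed
qed

text \<open>The exponent is 1 for the five shapes of nontrivial powers of 12B, 5 for 10A and 7 for
  21AB, where the power has shape 2B or 3B. For all other shapes the order of \<open>g\<close>
  serves, since only the identity is to be reached.\<close>

lemma max_order_attained:
  assumes g: "g \<in> carrier M24" "cycle_shape g = atlas_shape N"
  obtains d where "d \<ge> 1" "power_of_12B (g ^^ d)" "M24.ord (g ^^ d) = max_order N"
proof -
  have lcm: "M24.ord f = p" if "f \<in> carrier M24" "\<And>l. l \<in># cycle_shape f \<Longrightarrow> l = p" for f p
  proof -
    have "card (Orbits.orbit f 1) \<in># cycle_shape f"
      unfolding set_cycle_shape by (rule imageI) simp
    with that(2) have "set_mset (cycle_shape f) = {p}" by blast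
    with that(1) show ?thesis by (simp add: ord_M24)
  qed
  consider "N \<in> {C2B, C3B, C4C, C6B, C12B}" | "N = C10A" | "N = C21AB" | "max_order N = 1"
    by (cases N) (simp_all add: max_order_def)
  then show thesis
  proof cases
    case 1
    have "M24.ord g = max_order N"
      using 1 g by (intro lcm) (auto simp: max_order_def)
    with 1 g that[of 1] show thesis by (auto simp: power_of_12B_by_shape)
  next
    case 2
    have f: "g ^^ 5 \<in> carrier M24" using g(1) by (rule funpow_in_carrier_M24)
    have l: "l = 2" if "l \<in># cycle_shape (g ^^ 5)" for l
      using g that 2 by (intro funpow_prime_shape[of g 2 5]) auto
    obtain M where M: "cycle_shape (g ^^ 5) = atlas_shape M"
      using shape_of_atlas_name[OF f] by blast
    have "\<forall>l \<in> set (shape_list M). l = 2"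
      using l unfolding M mset_shape_list[symmetric] set_mset_mset by blast
    then have "M = C2B" by (cases M) simp_all
    with f M have "power_of_12B (g ^^ 5)" by (intro power_of_12B_by_shape[where N = M]) auto
    moreover have "M24.ord (g ^^ 5) = 2" using f l by (rule lcm)
    moreover have "max_order N = 2" using 2 by (simp add: max_order_def)
    ultimately show thesis by (intro that[of 5]) simp_all
  next
    case 3
    have f: "g ^^ 7 \<in> carrier M24" using g(1) by (rule funpow_in_carrier_M24)
    have l: "l = 3" if "l \<in># cycle_shape (g ^^ 7)" for l
      using g that 3 by (intro funpow_prime_shape[of g 3 7]) auto
    obtain M where M: "cycle_shape (g ^^ 7) = atlas_shape M"
      using shape_of_atlas_name[OF f] by blast
    have "\<forall>l \<in> set (shape_list M). l = 3"
      using l unfolding M mset_shape_list[symmetric] set_mset_mset by blast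
    then have "M = C3B" by (cases M) simp_all
    with f M have "power_of_12B (g ^^ 7)" by (intro power_of_12B_by_shape[where N = M]) auto
    moreover have "M24.ord (g ^^ 7) = 3" using f l by (rule lcm)
    moreover have "max_order N = 3" using 3 by (simp add: max_order_def)
    ultimately show thesis by (intro that[of 7]) simp_all
  next
    case 4
    have "M24.ord g \<ge> 1" using M24.ord_ge_1[OF finite_M24 g(1)] .
    moreover have "M24.ord id = 1" using M24.ord_id by simp
    ultimately show thesis
      using that[of "M24.ord g"] 4 funpow_ord_M24[OF g(1)] power_of_12B_id by simp
  qed
qed

section \<open>From elements to conjugacy classes\<close>

lemma class_of_powers_of_12B_iff:
  assumes "h \<in> carrier M24"
  shows "class_of_powers_of_12B (conj_class h) \<longleftrightarrow> power_of_12B h"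
proof
  assume "class_of_powers_of_12B (conj_class h)"
  then obtain Z z d where Z: "Z \<in> conj_classes M24" "atlas_name_of Z = C12B" "z \<in> Z" "d \<ge> 1"
    "z ^^ d \<in> conj_class h"
    unfolding class_of_powers_of_12B_def power_up_def pow_M24 by blast
  have "power_of_12B z"
    using class_memE[OF Z(1,3)] Z(2) shape_of_atlas_name
    by (intro power_of_12B_by_shape[where N = C12B]) auto
  then have "power_of_12B (z ^^ d)" using Z(4) by (rule power_of_12B_funpow)
  moreover have "conj_class h = conj_class (z ^^ d)"
    using Z(5) assms by (metis class_memE(2) conj_classes_M24 imageI)
  ultimately show "power_of_12B h" using power_of_12B_class conj_class_self by metis
next
  assume "power_of_12B h"
  then obtain z d where z: "z \<in> carrier M24" "cycle_shape z = atlas_shape C12B" "d \<ge> 1" "h = z ^^ d"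
    by (auto simp: power_of_12B_def)
  have "power_up M24 (conj_class z) (conj_class h)"
    unfolding power_up_def pow_M24 using z(3,4) conj_class_self by metis
  with z atlas_name_of_class assms show "class_of_powers_of_12B (conj_class h)"
    unfolding class_of_powers_of_12B_def conj_classes_M24 by blast
qed

text \<open>A class containing \<open>g ^^ d\<close> is the class of \<open>g ^^ d\<close>, so the
  classes compete for the maximum through powers of elements of \<open>X\<close>, to which the
  bounds for elements apply.\<close>

lemma candidate_iff:
  assumes "X \<in> conj_classes M24"
  shows "class_of_powers_of_12B Y \<and> power_up M24 X Y \<longleftrightarrow>
    (\<exists>g \<in> X. \<exists>d \<ge> 1. power_of_12B (g ^^ d) \<and> Y = conj_class (g ^^ d))"
proof
  assume *: "class_of_powers_of_12B Y \<and> power_up M24 X Y"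
  then obtain g d where g: "g \<in> X" "d \<ge> 1" "g ^^ d \<in> Y" unfolding power_up_def pow_M24 by blast
  have "Y \<in> conj_classes M24" using * unfolding class_of_powers_of_12B_def by blast
  with g(3) have "g ^^ d \<in> carrier M24" "Y = conj_class (g ^^ d)" by (rule class_memE[rotated])+
  with * g show "\<exists>g \<in> X. \<exists>d \<ge> 1. power_of_12B (g ^^ d) \<and> Y = conj_class (g ^^ d)"
    using class_of_powers_of_12B_iff by blast
next
  assume "\<exists>g \<in> X. \<exists>d \<ge> 1. power_of_12B (g ^^ d) \<and> Y = conj_class (g ^^ d)"
  then obtain g d where g: "g \<in> X" "d \<ge> 1" "power_of_12B (g ^^ d)" "Y = conj_class (g ^^ d)" by blast
  have "g ^^ d \<in> carrier M24"
    using class_memE(1)[OF assms g(1)] by (rule funpow_in_carrier_M24)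
  then have "class_of_powers_of_12B Y" using g(3,4) class_of_powers_of_12B_iff by simp
  moreover have "power_up M24 X Y"
    unfolding power_up_def pow_M24 g(4) using g(1,2) conj_class_self by blast
  ultimately show "class_of_powers_of_12B Y \<and> power_up M24 X Y" ..
qed

lemma candidate_order_le:
  assumes "X \<in> conj_classes M24" "class_of_powers_of_12B Y" "power_up M24 X Y"
  shows "class_order M24 Y \<le> max_order (atlas_name_of X)"
proof -
  obtain g d where g: "g \<in> X" "d \<ge> 1" "power_of_12B (g ^^ d)" "Y = conj_class (g ^^ d)"
    using assms candidate_iff by blast
  have "g \<in> carrier M24" "cycle_shape g = atlas_shape (atlas_name_of X)"
    using class_memE[OF assms(1) g(1)] shape_of_atlas_name by auto
  then show ?thesis
    using ord_le_max_order g(2,3) by (simp add: g(4) class_order_M24 funpow_in_carrier_M24)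
qed

lemma candidate_order_attained:
  assumes "X \<in> conj_classes M24"
  obtains Y where "class_of_powers_of_12B Y" "power_up M24 X Y"
    "class_order M24 Y = max_order (atlas_name_of X)"
proof -
  obtain g where g: "g \<in> carrier M24" "g \<in> X" "X = conj_class g" using class_obtains[OF
   assms] .
  then have "cycle_shape g = atlas_shape (atlas_name_of X)" using shape_of_atlas_name by simp
  with g(1) obtain d where d: "d \<ge> 1" "power_of_12B (g ^^ d)"
    "M24.ord (g ^^ d) = max_order (atlas_name_of X)"
    using max_order_attained by blast
  with g candidate_iff[OF assms, of "conj_class (g ^^ d)"] show thesis
    by (intro that[of "conj_class (g ^^ d)"]) (auto simp: class_order_M24 funpow_in_carrier_M24)
qed

lemma max_power_class_exists:
  assumes "X \<in> conj_classes M24"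
  shows "\<exists>Y. max_power_class X Y"
proof -
  obtain Y where "class_of_powers_of_12B Y" "power_up M24 X Y"
    "class_order M24 Y = max_order (atlas_name_of X)"
    using candidate_order_attained[OF assms] .
  then have "max_power_class X Y"
    unfolding max_power_class_def is_arg_max_def using candidate_order_le[OF assms] by (metis
     not_le)
  then show ?thesis ..
qed

text \<open>The upper bound is attained by some class, so every maximal \<open>Y\<close> attains it;
  the order of \<open>Y\<close> depends only on the name of \<open>X\<close>.\<close>

lemma max_power_class_order:
  assumes "X \<in> conj_classes M24" "max_power_class X Y"
  shows "class_order M24 Y = max_order (atlas_name_of X)"
proof -
  have Y: "class_of_powers_of_12B Y" "power_up M24 X Y"
    using assms(2) by (auto simp: max_power_class_def is_arg_max_def)
  obtain Y' where "class_of_powers_of_12B Y'" "power_up M24 X Y'"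
    "class_order M24 Y' = max_order (atlas_name_of X)"
    using candidate_order_attained[OF assms(1)] .
  then have "max_order (atlas_name_of X) \<le> class_order M24 Y"
    using assms(2) unfolding max_power_class_def is_arg_max_def by (metis not_le)
  with candidate_order_le[OF assms(1) Y] show ?thesis by simp
qed

fun atlas_order :: "atlas_name \<Rightarrow> nat" where
  "atlas_order C1A = 1" | "atlas_order C2A = 2" | "atlas_order C2B = 2" | "atlas_order C3A = 3"
| "atlas_order C3B = 3" | "atlas_order C4A = 4" | "atlas_order C4B = 4" | "atlas_order C4C = 4"
| "atlas_order C5A = 5" | "atlas_order C6A = 6" | "atlas_order C6B = 6" | "atlas_order C7AB = 7"
| "atlas_order C8A = 8" | "atlas_order C10A = 10" | "atlas_order C11A = 11"
| "atlas_order C12A = 12" | "atlas_order C12B = 12" | "atlas_order C14AB = 14"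
| "atlas_order C15AB = 15" | "atlas_order C21AB = 21" | "atlas_order C23AB = 23"

lemma Lcm_atlas_shape: "Lcm (set_mset (atlas_shape N)) = atlas_order N"
  unfolding mset_shape_list[symmetric] set_mset_mset
  by (cases N) (simp_all add: lcm_nat_def gcd_non_0_nat)

lemma class_order_atlas:
  assumes "X \<in> conj_classes M24"
  shows "class_order M24 X = atlas_order (atlas_name_of X)"
proof -
  obtain g where g: "g \<in> carrier M24" "g \<in> X" "X = conj_class g" using class_obtains[OF
   assms] .
  then show ?thesis
    using shape_of_atlas_name[OF g(1)] by (simp add: class_order_M24 ord_M24 Lcm_atlas_shape)
qed

text \<open>Fixed points of \<open>g\<close> persist in its powers, and the order of a power divides
  that of \<open>g\<close>; this leaves 4A, 4C, 12A and 12B. Elements of shape 4C or 12B are powers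
  of 12B elements, so their powers are semiregular, whereas 4A has cycles of lengths 2 and
  4.\<close>

lemma power_up_4A:
  assumes g: "g \<in> carrier M24" "cycle_shape g = atlas_shape N"
    and d: "d \<ge> 1" "cycle_shape (g ^^ d) = atlas_shape C4A"
  shows "N \<in> {C4A, C12A}"
proof -
  let ?h = "g ^^ d"
  have h: "?h \<in> carrier M24" using g(1) by (rule funpow_in_carrier_M24)
  have "1 \<notin># atlas_shape N"
  proof
    assume "1 \<in># atlas_shape N"
    then obtain x where x: "x \<in> {1..24}" "card (Orbits.orbit g x) = 1"
      using point_of_length[OF g(2)] by blast
    then have "(?h ^^ 1) x = x"
      using funpow_fixes_iff[OF M24_permutation[OF g(1)], of d x] by simp
    then have "card (Orbits.orbit ?h x) = 1"
      using funpow_fixes_iff[OF M24_permutation[OF h], of 1 x] by simp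
    then have "1 \<in># cycle_shape ?h" using x(1) unfolding set_cycle_shape by force
    then show False unfolding d(2) by simp
  qed
  moreover have "4 dvd atlas_order N"
  proof -
    have "?h ^^ M24.ord g = (g ^^ M24.ord g) ^^ d" by (simp add: funpow_mult mult.commute)
    then have "M24.ord ?h dvd M24.ord g"
      using funpow_ord_M24[OF g(1)] funpow_id_ord_dvd[OF h] by (metis id_funpow)
    then show ?thesis
      using g h d(2) by (simp add: ord_M24 Lcm_atlas_shape)
  qed
  moreover have "\<not> power_of_12B g"
  proof
    assume "power_of_12B g"
    then have pow: "power_of_12B ?h" using d(1) by (rule power_of_12B_funpow)
    have "2 \<in># atlas_shape C4A" by simp
    then obtain x where x: "x \<in> {1..24}" "card (Orbits.orbit ?h x) = 2"
      using point_of_length[OF d(2)] by blast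
    then have "(?h ^^ 2) x = x" using funpow_fixes_iff[OF M24_permutation[OF h]] by simp
    with pow have "?h ^^ 2 = id" using x(1) by (rule power_of_12B_semiregular)
    then show False unfolding funpow_id_iff[OF h] d(2) by simp
  qed
  then have "N \<notin> {C4C, C12B}" using power_of_12B_by_shape[OF g] by blast
  ultimately show ?thesis by (cases N) auto
qed

theorem theorem5:
  shows
    "(\<forall>X \<in> conj_classes M24. \<exists>Y. max_power_class X Y) \<and>
     (\<forall>X Y n k. X \<in> conj_classes M24 \<and> n = class_order M24 X \<and>
        max_power_class X Y \<and> k = class_order M24 Y \<longrightarrow>
        (class_thread X = (2 * n, k) \<longleftrightarrow> atlas_name_of X \<notin> {C4A, C12A}) \<and>
        (atlas_name_of X \<in> {C4A, C12A} \<longrightarrow> class_thread X = (2 * n, 2)) \<and>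
        (atlas_name_of X \<in> {C1A, C2A, C3A, C4A, C4B, C5A, C6A, C7AB, C8A, C11A, C12A,
           C14AB, C15AB, C23AB} \<longrightarrow> k = 1) \<and>
        (atlas_name_of X \<in> {C2B, C10A} \<longrightarrow> k = 2) \<and>
        (atlas_name_of X \<in> {C3B, C21AB} \<longrightarrow> k = 3) \<and>
        (atlas_name_of X = C4C \<longrightarrow> k = 4) \<and>
        (atlas_name_of X = C6B \<longrightarrow> k = 6) \<and>
        (atlas_name_of X = C12B \<longrightarrow> k = 12)) \<and>
     (\<exists>A \<in> conj_classes M24. \<exists>B \<in> conj_classes M24.
        A \<noteq> B \<and> atlas_name_of A = C4A \<and> atlas_name_of B = C12A \<and>
        {X \<in> conj_classes M24. \<exists>Y. max_power_class X Y \<and>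
           class_thread X \<noteq> (2 * class_order M24 X, class_order M24 Y)} = {A, B} \<and>
        {X \<in> conj_classes M24. power_up M24 X A} = {A, B})"
proof (intro conjI)
  show "\<forall>X \<in> conj_classes M24. \<exists>Y. max_power_class X Y"
    using max_power_class_exists by blast
  have thread: "class_thread X = (2 * class_order M24 X, class_order M24 Y) \<longleftrightarrow>
      atlas_name_of X \<notin> {C4A, C12A}"
    if "X \<in> conj_classes M24" "max_power_class X Y" for X Y
    unfolding class_order_atlas[OF that(1)] max_power_class_order[OF that] class_thread_def
    by (cases "atlas_name_of X") (simp_all add: max_order_def)
  show "\<forall>X Y n k. X \<in> conj_classes M24 \<and> n = class_order M24 X \<and>
      max_power_class X Y \<and> k = class_order M24 Y \<longrightarrow>
      (class_thread X = (2 * n, k) \<longleftrightarrow> atlas_name_of X \<notin> {C4A, C12A}) \<and>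
      (atlas_name_of X \<in> {C4A, C12A} \<longrightarrow> class_thread X = (2 * n, 2)) \<and>
      (atlas_name_of X \<in> {C1A, C2A, C3A, C4A, C4B, C5A, C6A, C7AB, C8A, C11A, C12A,
         C14AB, C15AB, C23AB} \<longrightarrow> k = 1) \<and>
      (atlas_name_of X \<in> {C2B, C10A} \<longrightarrow> k = 2) \<and>
      (atlas_name_of X \<in> {C3B, C21AB} \<longrightarrow> k = 3) \<and>
      (atlas_name_of X = C4C \<longrightarrow> k = 4) \<and>
      (atlas_name_of X = C6B \<longrightarrow> k = 6) \<and>
      (atlas_name_of X = C12B \<longrightarrow> k = 12)"
  proof (intro allI impI, elim conjE)
    fix X Y n k
    assume X: "X \<in> conj_classes M24" "max_power_class X Y"
      and n: "n = class_order M24 X" and k: "k = class_order M24 Y"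
    have "class_thread X = (2 * n, k) \<longleftrightarrow> atlas_name_of X \<notin> {C4A, C12A}"
      unfolding n k using X by (rule thread)
    moreover have "n = atlas_order (atlas_name_of X)" "k = max_order (atlas_name_of X)"
      unfolding n k using X by (simp_all add: class_order_atlas max_power_class_order)
    ultimately show "(class_thread X = (2 * n, k) \<longleftrightarrow> atlas_name_of X \<notin> {C4A, C12A}) \<and>
      (atlas_name_of X \<in> {C4A, C12A} \<longrightarrow> class_thread X = (2 * n, 2)) \<and>
      (atlas_name_of X \<in> {C1A, C2A, C3A, C4A, C4B, C5A, C6A, C7AB, C8A, C11A, C12A,
         C14AB, C15AB, C23AB} \<longrightarrow> k = 1) \<and>
      (atlas_name_of X \<in> {C2B, C10A} \<longrightarrow> k = 2) \<and>
      (atlas_name_of X \<in> {C3B, C21AB} \<longrightarrow> k = 3) \<and>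
      (atlas_name_of X = C4C \<longrightarrow> k = 4) \<and>
      (atlas_name_of X = C6B \<longrightarrow> k = 6) \<and>
      (atlas_name_of X = C12B \<longrightarrow> k = 12)"
      by (cases "atlas_name_of X") (simp_all add: class_thread_def max_order_def)
  qed
  define A B where "A = conj_class (entry tau ^^ 3)" and "B = conj_class (entry tau)"
  have classes: "A \<in> conj_classes M24" "B \<in> conj_classes M24"
    unfolding A_def B_def conj_classes_M24
    by (intro imageI funpow_in_carrier_M24 rho_tau_in_M24)+
  have names: "atlas_name_of A = C4A" "atlas_name_of B = C12A"
    unfolding A_def B_def by (rule atlas_name_of_class, rule shape_tau_cube shape_tau)+
  \<comment> \<open>Equal names alone do not give equal classes; conjugacy with a fixed power of
    \<open>tau\<close> does, and so the exceptions are two classes rather than two names.\<close>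
  have unique: "X = A" if "X \<in> conj_classes M24" "atlas_name_of X = C4A" for X
    using class_obtains[OF that(1)] that(2) shape_of_atlas_name conj_class_representative[of _ C4A]
    unfolding A_def by (metis conjugators.simps(5) list.distinct(1) representative.simps(5))
  have unique': "X = B" if "X \<in> conj_classes M24" "atlas_name_of X = C12A" for X
    using class_obtains[OF that(1)] that(2) shape_of_atlas_name conj_class_representative[of _ C12A]
    unfolding B_def by (metis conjugators.simps(6) list.distinct(1) representative.simps(6))
  have iff: "X \<in> {A, B} \<longleftrightarrow> X \<in> conj_classes M24 \<and> atlas_name_of X \<in> {C4A, C12A}" for X
  proof
    assume "X \<in> {A, B}"
    then consider "X = A" | "X = B" by blast
    then show "X \<in> conj_classes M24 \<and> atlas_name_of X \<in> {C4A, C12A}"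
      by cases (simp_all add: classes names)
  qed (use unique[of X] unique'[of X] in blast)
  have "{X \<in> conj_classes M24. \<exists>Y. max_power_class X Y \<and>
      class_thread X \<noteq> (2 * class_order M24 X, class_order M24 Y)} = {A, B}"
    unfolding set_eq_iff iff mem_Collect_eq using thread max_power_class_exists by blast
  moreover have "{X \<in> conj_classes M24. power_up M24 X A} = {A, B}"
  proof (intro equalityI subsetI)
    fix X assume "X \<in> {X \<in> conj_classes M24. power_up M24 X A}"
    then obtain g d where X: "X \<in> conj_classes M24" "g \<in> X" "d \<ge> 1" "g ^^ d \<in> A"
      unfolding power_up_def pow_M24 by blast
    have "cycle_shape (g ^^ d) = atlas_shape C4A"
      using X(4) cycle_shape_class shape_tau_cube unfolding A_def by metis
    then have "atlas_name_of X \<in> {C4A, C12A}"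
      using class_memE[OF X(1,2)] shape_of_atlas_name X(3) by (intro power_up_4A[of g _ d]) auto
    with X(1) iff show "X \<in> {A, B}" by blast
  next
    fix X assume "X \<in> {A, B}"
    moreover have "power_up M24 A A"
      unfolding power_up_def pow_M24 A_def using conj_class_self
      by (intro bexI[of _ "entry tau ^^ 3"] exI[of _ 1]) auto
    moreover have "power_up M24 B A"
      unfolding power_up_def pow_M24 A_def B_def using conj_class_self
      by (intro bexI[of _ "entry tau"] exI[of _ 3]) auto
    ultimately show "X \<in> {X \<in> conj_classes M24. power_up M24 X A}" using classes by auto
  qed
  moreover have "A \<noteq> B" using names by auto
  ultimately show "\<exists>A \<in> conj_classes M24. \<exists>B \<in> conj_classes M24.
      A \<noteq> B \<and> atlas_name_of A = C4A \<and> atlas_name_of B = C12A \<and>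
      {X \<in> conj_classes M24. \<exists>Y. max_power_class X Y \<and>
         class_thread X \<noteq> (2 * class_order M24 X, class_order M24 Y)} = {A, B} \<and>
      {X \<in> conj_classes M24. power_up M24 X A} = {A, B}"
    using classes names by blast
qed

end
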